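(* Let $(X,\mathcal B)$ be a standard Borel space, let $G$ be a locally compact second countable abelian group, and let $\Gamma$ be a hyperfinite countable subgroup of $Aut(X,\mathcal B)$ acting freely on $X$. Then the group $Z^1(\Gamma\times X,G)$ of cocycles is closed in $\mathcal F(\Gamma\times X,G)$ (with respect to the topology $\mathcal T$), and it is a separable topological group.
   Context: $Aut(X,\mathcal B)$ is the group of Borel bijections of $X$ onto itself. $\Gamma$ acts freely if $\gamma x\ne x$ for all $x\in X$ and all non-identity $\gamma\in\Gamma$. The full group is $[\Gamma]=\{R\in Aut(X,\mathcal B): Rx\in\Gamma x\ \forall x\}$. $\Gamma$ is hyperfinite if there are finite subgroups $\Gamma_1\subset\Gamma_2\subset\cdots$ of $[\Gamma]$ with $\Gamma x=\bigcup_i\Gamma_ix$ for every $x\in X$. $G$ is written additively. A cocycle is a Borel function $a:\Gamma\times X\to G$ ($\Gamma$ discrete) with $a(\gamma_1\gamma_2,x)=a(\gamma_1,\gamma_2x)+a(\gamma_2,x)$ for all $\gamma_1,\gamma_2,x$ and $a(\mathbb 1,x)=0$, where $\mathbb 1$ is the identity map. $Z^1(\Gamma\times X,G)$ is the group of all cocycles under pointwise addition. For a standard Borel space $Y$, $\mathcal F(Y,G)$ is the abelian group of all Borel functions $Y\to G$ and $\mathcal M_1(Y)$ is the set of Borel probability measures on $Y$. Fix a translation-invariant metric $d$ on $G$ compatible with its topology and write $|g-h|=d(g,h)$. The topology $\mathcal T$ on $\mathcal F(Y,G)$ has as base the sets $\{g\in\mathcal F(Y,G): \mu_i(\{y:|f(y)-g(y)|>\epsilon\})<\delta,\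 i=1,\dots,n\}$, where $f\in\mathcal F(Y,G)$, $n\in\mathbb N$, $\mu_1,\dots,\mu_n\in\mathcal M_1(Y)$, $\epsilon,\delta>0$. Here $Y=\Gamma\times X$ with $\Gamma$ discrete, and $Z^1(\Gamma\times X,G)$ has the subspace topology.
   Formalization: The displayed sets with strict ">" are taken as basic neighbourhoods of their centre f, not as a base of open sets: for Y a point and G = R they are closed intervals, which form no base; with "≥" in place of ">" they are an open base of the same topology. *)

theory Defs
  imports "HOL-Probability.Probability" "HOL-Algebra.Bij"
begin

text \<open>Only the \<sigma>-algebra of a \<open>'a measure\<close> is used for Borel spaces; its measure plays no role.
  The space is allowed to be any subset of the type (possibly empty).\<close>

definition standard_borel_space :: "'a measure \<Rightarrow> bool" where
  "standard_borel_space X \<longleftrightarrow>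
     (\<exists>T. topspace T = space X \<and> completely_metrizable_space T \<and> separable_space T \<and>
          sets X = sigma_sets (topspace T) {U. openin T U})"

text \<open>Elements of \<open>Aut(X,\<B>)\<close> are extensional (\<open>undefined\<close> off the space), so that
  equality of automorphisms is equality on the space. As usual for a Borel bijection, the inverse is
  required to be Borel too (on a standard Borel space this is automatic, by Lusin-Souslin).\<close>

definition borel_Aut :: "'a measure \<Rightarrow> ('a \<Rightarrow> 'a) monoid" where
  "borel_Aut X = (BijGroup (space X))
     \<lparr>carrier := {f \<in> Bij (space X). f \<in> X \<rightarrow>\<^sub>M X \<and> inv_into (space X) f \<in> X \<rightarrow>\<^sub>M X}\<rparr>"

definition orbit_of :: "('a \<Rightarrow> 'a) set \<Rightarrow> 'a \<Rightarrow> 'a set" where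
  "orbit_of \<Gamma> x = {\<gamma> x | \<gamma>. \<gamma> \<in> \<Gamma>}"

definition acts_freely :: "'a measure \<Rightarrow> ('a \<Rightarrow> 'a) set \<Rightarrow> bool" where
  "acts_freely X \<Gamma> \<longleftrightarrow> (\<forall>\<gamma>\<in>\<Gamma>. \<gamma> \<noteq> \<one>\<^bsub>borel_Aut X\<^esub> \<longrightarrow> (\<forall>x\<in>space X. \<gamma> x \<noteq> x))"

definition full_group :: "'a measure \<Rightarrow> ('a \<Rightarrow> 'a) set \<Rightarrow> ('a \<Rightarrow> 'a) monoid" where
  "full_group X \<Gamma> = (borel_Aut X)
     \<lparr>carrier := {R \<in> carrier (borel_Aut X). \<forall>x\<in>space X. R x \<in> orbit_of \<Gamma> x}\<rparr>"

definition hyperfinite :: "'a measure \<Rightarrow> ('a \<Rightarrow> 'a) set \<Rightarrow> bool" where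
  "hyperfinite X \<Gamma> \<longleftrightarrow>
     (\<exists>F :: nat \<Rightarrow> ('a \<Rightarrow> 'a) set.
        (\<forall>i. finite (F i) \<and> subgroup (F i) (full_group X \<Gamma>) \<and> F i \<subseteq> F (Suc i)) \<and>
        (\<forall>x\<in>space X. orbit_of \<Gamma> x = (\<Union>i. orbit_of (F i) x)))"

text \<open>Borel functions are likewise taken extensional, so that they are functions on the space only.\<close>

definition borel_functions :: "'y measure \<Rightarrow> ('y \<Rightarrow> 'g::{topological_space, group_add}) monoid" where
  "borel_functions Y =
     \<lparr>carrier = borel_measurable Y \<inter> extensional (space Y),
      mult = (\<lambda>f g. \<lambda>y\<in>space Y. f y + g y),
      one = (\<lambda>y\<in>space Y. 0)\<rparr>"

definition borel_probabilities :: "'y measure \<Rightarrow> 'y measure set" where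
  "borel_probabilities Y = {\<mu>. prob_space \<mu> \<and> sets \<mu> = sets Y}"

definition basic_nbhd ::
  "('g \<Rightarrow> 'g \<Rightarrow> real) \<Rightarrow> 'y measure \<Rightarrow> ('y \<Rightarrow> 'g::{topological_space, group_add}) \<Rightarrow>
   'y measure set \<Rightarrow> real \<Rightarrow> real \<Rightarrow> ('y \<Rightarrow> 'g) set" where
  "basic_nbhd d Y f N \<epsilon> \<delta> =
     {g \<in> carrier (borel_functions Y). \<forall>\<mu>\<in>N. measure \<mu> {y \<in> space Y. d (f y) (g y) > \<epsilon>} < \<delta>}"

text \<open>The sets \<open>basic_nbhd d Y f N \<epsilon> \<delta>\<close> form a base of neighbourhoods of \<open>f\<close> (the base of the
  topology is to be read this way). They cannot in general be declared open: with \<open>Y\<close> a point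
  and \<open>G = \<real>\<close> they are the closed intervals of positive length (for \<open>\<delta> \<le> 1\<close>), two of which can
  meet in a point. With \<open>d (f y) (g y) \<ge> \<epsilon>\<close> in place of \<open>d (f y) (g y) > \<epsilon>\<close> one gets an honest base
  of open sets of the same topology, see \<open>base_measure_topology\<close> below.\<close>

definition measure_topology ::
  "('g \<Rightarrow> 'g \<Rightarrow> real) \<Rightarrow> 'y measure \<Rightarrow> ('y \<Rightarrow> 'g::{topological_space, group_add}) topology" where
  "measure_topology d Y = topology (\<lambda>U. U \<subseteq> carrier (borel_functions Y) \<and>
     (\<forall>f\<in>U. \<exists>N \<epsilon> \<delta>. finite N \<and> N \<subseteq> borel_probabilities Y \<and> \<epsilon> > 0 \<and> \<delta> > 0 \<and>
        basic_nbhd d Y f N \<epsilon> \<delta> \<subseteq> U))"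

definition invariant_compatible_metric ::
  "('g::{topological_space, group_add} \<Rightarrow> 'g \<Rightarrow> real) \<Rightarrow> bool" where
  "invariant_compatible_metric d \<longleftrightarrow>
     Metric_space UNIV d \<and> Metric_space.mtopology UNIV d = euclidean \<and>
     (\<forall>a b c. d (a + c) (b + c) = d a b \<and> d (c + a) (c + b) = d a b)"

text \<open>The group \<open>\<Gamma>\<close> being discrete, \<open>\<Gamma> \<times> X\<close> carries the product of the power set and the Borel
  \<sigma>-algebra.\<close>

abbreviation discrete_times :: "('a \<Rightarrow> 'a) set \<Rightarrow> 'a measure \<Rightarrow> (('a \<Rightarrow> 'a) \<times> 'a) measure" where
  "discrete_times \<Gamma> X \<equiv> count_space \<Gamma> \<Otimes>\<^sub>M X"

definition cocycles ::
  "('a \<Rightarrow> 'a) set \<Rightarrow> 'a measure \<Rightarrow> (('a \<Rightarrow> 'a) \<times> 'a \<Rightarrow> 'g::{topological_space, group_add}) monoid" where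
  "cocycles \<Gamma> X = (borel_functions (discrete_times \<Gamma> X))
     \<lparr>carrier := {a \<in> carrier (borel_functions (discrete_times \<Gamma> X)).
        (\<forall>\<gamma>\<^sub>1\<in>\<Gamma>. \<forall>\<gamma>\<^sub>2\<in>\<Gamma>. \<forall>x\<in>space X.
           a (\<gamma>\<^sub>1 \<otimes>\<^bsub>borel_Aut X\<^esub> \<gamma>\<^sub>2, x) = a (\<gamma>\<^sub>1, \<gamma>\<^sub>2 x) + a (\<gamma>\<^sub>2, x)) \<and>
        (\<forall>x\<in>space X. a (\<one>\<^bsub>borel_Aut X\<^esub>, x) = 0)}\<rparr>"

definition topological_group :: "('a, 'm) monoid_scheme \<Rightarrow> 'a topology \<Rightarrow> bool" where
  "topological_group H T \<longleftrightarrow>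
     group H \<and> topspace T = carrier H \<and>
     continuous_map (prod_topology T T) T (\<lambda>(a, b). a \<otimes>\<^bsub>H\<^esub> b) \<and>
     continuous_map T T (\<lambda>a. inv\<^bsub>H\<^esub> a)"


lemma measurable_restrict_self_iff: "(\<lambda>x\<in>space X. f x) \<in> X \<rightarrow>\<^sub>M Y \<longleftrightarrow> f \<in> X \<rightarrow>\<^sub>M Y"
  by (rule measurable_cong) simp

lemma group_borel_Aut: "group (borel_Aut X)"
proof -
  let ?S = "space X"
  have inv: "inv\<^bsub>BijGroup ?S\<^esub> f = (\<lambda>x\<in>?S. inv_into ?S f x)" if "f \<in> Bij ?S" for f
    using that by (rule inv_BijGroup)
  have "subgroup (carrier (borel_Aut X)) (BijGroup ?S)"
  proof (rule group.subgroupI[OF group_BijGroup])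
    show "carrier (borel_Aut X) \<subseteq> carrier (BijGroup ?S)"
      by (auto simp: borel_Aut_def BijGroup_def)
    have "inv_into ?S (\<lambda>x\<in>?S. x) \<in> X \<rightarrow>\<^sub>M X"
      by (rule measurable_cong[THEN iffD1, OF _ measurable_ident])
         (auto intro!: inv_into_f_eq[symmetric] simp: inj_on_def)
    moreover have "(\<lambda>x\<in>?S. x) \<in> X \<rightarrow>\<^sub>M X"
      by (rule measurable_cong[THEN iffD1, OF _ measurable_ident]) auto
    ultimately have "(\<lambda>x\<in>?S. x) \<in> carrier (borel_Aut X)"
      using id_Bij[of ?S] unfolding borel_Aut_def by simp
    then show "carrier (borel_Aut X) \<noteq> {}" by blast
  next
    fix f assume "f \<in> carrier (borel_Aut X)"
    then have f: "f \<in> Bij ?S" "f \<in> X \<rightarrow>\<^sub>M X" "inv_into ?S f \<in> X \<rightarrow>\<^sub>M X"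
      by (auto simp: borel_Aut_def)
    let ?g = "\<lambda>x\<in>?S. inv_into ?S f x"
    have g: "?g \<in> Bij ?S" by (rule restrict_inv_into_Bij[OF f(1)])
    have bf: "bij_betw f ?S ?S" using f(1) by (simp add: Bij_def)
    have bg: "bij_betw ?g ?S ?S" using g by (simp add: Bij_def)
    have "?g \<in> X \<rightarrow>\<^sub>M X" using f(3) by (simp add: measurable_restrict_self_iff)
    moreover have "inv_into ?S ?g \<in> X \<rightarrow>\<^sub>M X"
    proof (rule measurable_cong[THEN iffD1, OF _ f(2)])
      fix x assume x: "x \<in> ?S"
      have "?g (f x) = x" using bf x
        by (auto simp: bij_betw_def)
      then show "f x = inv_into ?S ?g x"
        using bf bg x by (metis bij_betw_imp_inj_on bij_betwE inv_into_f_f)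
    qed
    ultimately show "inv\<^bsub>BijGroup ?S\<^esub> f \<in> carrier (borel_Aut X)"
      using g by (simp add: inv[OF f(1)] borel_Aut_def)
  next
    fix f g assume "f \<in> carrier (borel_Aut X)" "g \<in> carrier (borel_Aut X)"
    then have f: "f \<in> Bij ?S" "f \<in> X \<rightarrow>\<^sub>M X" "inv_into ?S f \<in> X \<rightarrow>\<^sub>M X"
      and g: "g \<in> Bij ?S" "g \<in> X \<rightarrow>\<^sub>M X" "inv_into ?S g \<in> X \<rightarrow>\<^sub>M X"
      by (auto simp: borel_Aut_def)
    have bf: "bij_betw f ?S ?S" and bg: "bij_betw g ?S ?S" using f(1) g(1) by (auto simp: Bij_def)
    have c: "compose ?S f g \<in> Bij ?S" by (rule compose_Bij[OF f(1) g(1)])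
    have bc: "bij_betw (compose ?S f g) ?S ?S" using c by (simp add: Bij_def)
    have "compose ?S f g \<in> X \<rightarrow>\<^sub>M X"
      using measurable_comp[OF g(2) f(2)] by (simp add: compose_def comp_def measurable_restrict_self_iff)
    moreover have "inv_into ?S (compose ?S f g) \<in> X \<rightarrow>\<^sub>M X"
    proof (rule measurable_cong[THEN iffD1, OF _ measurable_comp[OF f(3) g(3)]])
      fix x assume x: "x \<in> ?S"
      let ?u = "inv_into ?S f x" and ?v = "inv_into ?S g (inv_into ?S f x)"
      have u: "?u \<in> ?S" "f ?u = x" using bf x
        by (auto simp: bij_betw_def intro: inv_into_into f_inv_into_f)
      have v: "?v \<in> ?S" "g ?v = ?u" using bg u(1)
        by (auto simp: bij_betw_def intro: inv_into_into f_inv_into_f)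
      have "compose ?S f g ?v = x" using u v by (simp add: compose_def)
      then show "(inv_into ?S g \<circ> inv_into ?S f) x = inv_into ?S (compose ?S f g) x"
        using bc v(1) by (metis bij_betw_imp_inj_on comp_apply inv_into_f_f)
    qed
    ultimately show "f \<otimes>\<^bsub>BijGroup ?S\<^esub> g \<in> carrier (borel_Aut X)"
      using c f(1) g(1) by (simp add: borel_Aut_def BijGroup_def)
  qed
  then have "group (BijGroup ?S\<lparr>carrier := carrier (borel_Aut X)\<rparr>)"
    by (rule subgroup.subgroup_is_group) (rule group_BijGroup)
  then show ?thesis by (simp add: borel_Aut_def)
qed

lemma borel_measurable_metric:
  fixes d :: "'g::{topological_group_add, second_countable_topology} \<Rightarrow> 'g \<Rightarrow> real"
  assumes d: "invariant_compatible_metric d"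
    and "f \<in> borel_measurable Y" "g \<in> borel_measurable Y"
  shows "(\<lambda>y. d (f y) (g y)) \<in> borel_measurable Y"
proof -
  interpret Metric_space UNIV d using d by (simp add: invariant_compatible_metric_def)
  have top: "mtopology = euclidean" using d by (simp add: invariant_compatible_metric_def)
  have "continuous_map (prod_topology mtopology mtopology) euclideanreal (\<lambda>(x, y). d x y)"
    using continuous_map_metric[of "metric (UNIV, d)"] by (simp add: mtopology_of_def)
  then have "continuous_on UNIV (\<lambda>p. d (fst p) (snd p))"
    by (simp add: top case_prod_unfold)
  from borel_measurable_continuous_Pair[OF assms(2,3) this] show ?thesis .
qed

lemma borel_probabilitiesD:
  assumes "\<mu> \<in> borel_probabilities Y"
  shows "prob_space \<mu>" "sets \<mu> = sets Y" "space \<mu> = space Y"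
  using assms sets_eq_imp_space_eq[of \<mu> Y] by (auto simp: borel_probabilities_def)

lemma
  fixes d :: "'g::{topological_group_add, second_countable_topology} \<Rightarrow> 'g \<Rightarrow> real"
  assumes "invariant_compatible_metric d" "\<mu> \<in> borel_probabilities Y"
    and "f \<in> carrier (borel_functions Y)" "g \<in> carrier (borel_functions Y)"
  shows sets_metric_gt: "{y \<in> space Y. d (f y) (g y) > \<epsilon>} \<in> sets \<mu>"
    and sets_metric_ge: "{y \<in> space Y. d (f y) (g y) \<ge> \<epsilon>} \<in> sets \<mu>"
proof -
  have "f \<in> borel_measurable Y" "g \<in> borel_measurable Y"
    using assms(3,4) by (simp_all add: borel_functions_def)
  then have m: "(\<lambda>y. d (f y) (g y)) \<in> borel_measurable Y"
    by (rule borel_measurable_metric[OF assms(1)])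
  show "{y \<in> space Y. d (f y) (g y) > \<epsilon>} \<in> sets \<mu>" "{y \<in> space Y. d (f y) (g y) \<ge> \<epsilon>} \<in> sets \<mu>"
    using m[THEN borel_measurable_iff_greater[THEN iffD1]] m[THEN borel_measurable_iff_ge[THEN iffD1]]
    unfolding borel_probabilitiesD(2)[OF assms(2)] by blast+
qed

lemma basic_nbhd_mono:
  fixes d :: "'g::{topological_group_add, second_countable_topology} \<Rightarrow> 'g \<Rightarrow> real"
  assumes d: "invariant_compatible_metric d" and N: "N \<subseteq> borel_probabilities Y"
    and f: "f \<in> carrier (borel_functions Y)"
    and le: "N' \<subseteq> N" "\<epsilon> \<le> \<epsilon>'" "\<delta> \<le> \<delta>'"
  shows "basic_nbhd d Y f N \<epsilon> \<delta> \<subseteq> basic_nbhd d Y f N' \<epsilon>' \<delta>'"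
proof
  fix g assume g: "g \<in> basic_nbhd d Y f N \<epsilon> \<delta>"
  then have gF: "g \<in> carrier (borel_functions Y)" by (simp add: basic_nbhd_def)
  have "measure \<mu> {y \<in> space Y. d (f y) (g y) > \<epsilon>'} < \<delta>'" if "\<mu> \<in> N'" for \<mu>
  proof -
    have \<mu>: "\<mu> \<in> N" "\<mu> \<in> borel_probabilities Y" using that le N by auto
    interpret prob_space \<mu> using \<mu>(2) by (rule borel_probabilitiesD)
    have "measure \<mu> {y \<in> space Y. d (f y) (g y) > \<epsilon>'} \<le> measure \<mu> {y \<in> space Y. d (f y) (g y) > \<epsilon>}"
      using le(2) by (intro finite_measure_mono sets_metric_gt[OF d \<mu>(2) f gF]) auto
    also have "\<dots> < \<delta>" using g \<mu>(1) by (simp add: basic_nbhd_def)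
    finally show ?thesis using le(3) by simp
  qed
  then show "g \<in> basic_nbhd d Y f N' \<epsilon>' \<delta>'" using gF by (simp add: basic_nbhd_def)
qed

lemma openin_measure_topology:
  fixes d :: "'g::{topological_group_add, second_countable_topology} \<Rightarrow> 'g \<Rightarrow> real"
  assumes d: "invariant_compatible_metric d"
  shows "openin (measure_topology d Y) U \<longleftrightarrow> U \<subseteq> carrier (borel_functions Y) \<and>
     (\<forall>f\<in>U. \<exists>N \<epsilon> \<delta>. finite N \<and> N \<subseteq> borel_probabilities Y \<and> \<epsilon> > 0 \<and> \<delta> > 0 \<and>
        basic_nbhd d Y f N \<epsilon> \<delta> \<subseteq> U)"
proof -
  define nb where "nb U f \<longleftrightarrow> (\<exists>N \<epsilon> \<delta>. finite N \<and> N \<subseteq> borel_probabilities Y \<and> \<epsilon> > 0 \<and> \<delta> > 0 \<and>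
        basic_nbhd d Y f N \<epsilon> \<delta> \<subseteq> U)" for U f
  define P where "P U \<longleftrightarrow> U \<subseteq> carrier (borel_functions Y) \<and> (\<forall>f\<in>U. nb U f)" for U
  have inter: "P (S \<inter> T)" if S: "P S" and T: "P T" for S T
  proof -
    have "nb (S \<inter> T) f" if "f \<in> S \<inter> T" for f
    proof -
      have f: "f \<in> S" "f \<in> T" "f \<in> carrier (borel_functions Y)" using that S by (auto simp: P_def)
      from S f have "nb S f" by (simp add: P_def)
      then obtain N \<epsilon> \<delta> where 1: "finite N" "N \<subseteq> borel_probabilities Y" "\<epsilon> > 0" "\<delta> > 0"
          "basic_nbhd d Y f N \<epsilon> \<delta> \<subseteq> S" unfolding nb_def by blast
      from T f have "nb T f" by (simp add: P_def)
      then obtain N' \<epsilon>' \<delta>' where 2: "finite N'" "N' \<subseteq> borel_probabilities Y" "\<epsilon>' > 0" "\<delta>' > 0"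
          "basic_nbhd d Y f N' \<epsilon>' \<delta>' \<subseteq> T" unfolding nb_def by blast
      let ?V = "basic_nbhd d Y f (N \<union> N') (min \<epsilon> \<epsilon>') (min \<delta> \<delta>')"
      have NN: "N \<union> N' \<subseteq> borel_probabilities Y" using 1 2 by blast
      have "?V \<subseteq> basic_nbhd d Y f N \<epsilon> \<delta>" "?V \<subseteq> basic_nbhd d Y f N' \<epsilon>' \<delta>'"
        by (rule basic_nbhd_mono[OF d NN f(3)]; simp)+
      then have "?V \<subseteq> S \<inter> T" using 1(5) 2(5) by blast
      moreover have "finite (N \<union> N')" "min \<epsilon> \<epsilon>' > 0" "min \<delta> \<delta>' > 0" using 1 2 by auto
      ultimately show ?thesis unfolding nb_def using NN by blast
    qed
    then show ?thesis using S unfolding P_def by blast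
  qed
  moreover have "P (\<Union>K)" if K: "\<forall>S\<in>K. P S" for K
  proof -
    have "nb (\<Union>K) f" if S: "S \<in> K" "f \<in> S" for S f
    proof -
      have "nb S f" using K S by (auto simp: P_def)
      then show ?thesis using S(1) unfolding nb_def by (meson Sup_upper order_trans)
    qed
    then show ?thesis using K unfolding P_def by blast
  qed
  ultimately have "istopology P" unfolding istopology_def by blast
  then have "openin (topology P) U \<longleftrightarrow> P U" by (simp add: topology_inverse')
  then show ?thesis unfolding measure_topology_def P_def nb_def .
qed

lemma topspace_measure_topology:
  fixes d :: "'g::{topological_group_add, second_countable_topology} \<Rightarrow> 'g \<Rightarrow> real"
  assumes d: "invariant_compatible_metric d"
  shows "topspace (measure_topology d Y) = carrier (borel_functions Y)"
proof -
  have "openin (measure_topology d Y) (carrier (borel_functions Y))"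
    unfolding openin_measure_topology[OF d]
    by (intro conjI ballI exI[of _ "{}"] exI[of _ 1]) (auto simp: basic_nbhd_def)
  then show ?thesis
    by (intro subset_antisym openin_subset) (use openin_topspace openin_measure_topology[OF d] in blast)+
qed

lemma base_measure_topology:
  fixes d :: "'g::{topological_group_add, second_countable_topology} \<Rightarrow> 'g \<Rightarrow> real"
    and Y :: "'y measure"
  assumes d: "invariant_compatible_metric d"
  defines "W \<equiv> \<lambda>f N \<epsilon> \<delta>. {g \<in> carrier (borel_functions Y).
     \<forall>\<mu>\<in>N. measure \<mu> {y \<in> space Y. d (f y) (g y) \<ge> \<epsilon>} < \<delta>}"
  shows "openin (measure_topology d Y) =
     arbitrary union_of (\<lambda>U. \<exists>f N \<epsilon> \<delta>. f \<in> carrier (borel_functions Y) \<and> finite N \<and>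
       N \<subseteq> borel_probabilities Y \<and> \<epsilon> > 0 \<and> \<delta> > 0 \<and> U = W f N \<epsilon> \<delta>)"
proof -
  interpret Metric_space UNIV d using d by (simp add: invariant_compatible_metric_def)
  let ?F = "carrier (borel_functions Y) :: ('y \<Rightarrow> 'g) set"
  have W_open: "openin (measure_topology d Y) (W f N \<epsilon> \<delta>)"
    if f: "f \<in> ?F" and N: "finite N" "N \<subseteq> borel_probabilities Y" for f N \<epsilon> \<delta>
    unfolding openin_measure_topology[OF d]
  proof (intro conjI ballI)
    show "W f N \<epsilon> \<delta> \<subseteq> ?F" by (auto simp: W_def)
    fix g assume g: "g \<in> W f N \<epsilon> \<delta>"
    then have gF: "g \<in> ?F" by (simp add: W_def)
    define A where "A \<eta> = {y \<in> space Y. d (f y) (g y) \<ge> \<epsilon> - \<eta>}" for \<eta>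
    have "\<exists>n. measure \<mu> (A (1 / Suc n)) < \<delta> - 1 / Suc n" if \<mu>: "\<mu> \<in> N" for \<mu>
    proof -
      have \<mu>': "\<mu> \<in> borel_probabilities Y" using \<mu> N by auto
      interpret prob_space \<mu> using \<mu>' by (rule borel_probabilitiesD)
      have "decseq (\<lambda>n. A (1 / Suc n))"
        unfolding decseq_def A_def
      proof (intro allI impI subsetI, clarsimp)
        fix m n :: nat and y assume "m \<le> n" and *: "\<epsilon> - 1 / (1 + real n) \<le> d (f y) (g y)"
        then have "1 / (1 + real n) \<le> 1 / (1 + real m)" by (simp add: frac_le)
        with * show "\<epsilon> - 1 / (1 + real m) \<le> d (f y) (g y)" by linarith
      qed
      then have "(\<lambda>n. measure \<mu> (A (1 / Suc n))) \<longlonglongrightarrow> measure \<mu> (\<Inter>n. A (1 / Suc n))"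
        unfolding A_def
        by (intro finite_Lim_measure_decseq) (auto intro: sets_metric_ge[OF d \<mu>' f gF])
      moreover have "(\<Inter>n. A (1 / Suc n)) = {y \<in> space Y. d (f y) (g y) \<ge> \<epsilon>}"
      proof -
        have "\<epsilon> \<le> r" if "\<And>n. \<epsilon> - 1 / Suc n \<le> r" for r :: real
        proof (rule field_le_epsilon)
          fix e :: real assume "e > 0"
          then obtain n where "1 / Suc n < e" using nat_approx_posE by blast
          then show "\<epsilon> \<le> r + e" using that[of n] by linarith
        qed
        moreover have "\<epsilon> - 1 / Suc n \<le> r" if "\<epsilon> \<le> r" for r :: real and n
          using that by (smt (verit) of_nat_0_less_iff zero_less_Suc zero_less_divide_1_iff)
        ultimately show ?thesis unfolding A_def by (simp add: set_eq_iff) blast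
      qed
      ultimately have "(\<lambda>n. measure \<mu> (A (1 / Suc n)) + 1 / Suc n)
          \<longlonglongrightarrow> measure \<mu> {y \<in> space Y. d (f y) (g y) \<ge> \<epsilon>} + 0"
        using LIMSEQ_Suc[OF lim_1_over_n] by (intro tendsto_add) auto
      moreover have "measure \<mu> {y \<in> space Y. d (f y) (g y) \<ge> \<epsilon>} + 0 < \<delta>"
        using g \<mu> by (simp add: W_def)
      ultimately have "\<forall>\<^sub>F n in sequentially. measure \<mu> (A (1 / Suc n)) + 1 / Suc n < \<delta>"
        by (rule order_tendstoD)
      then obtain n where "measure \<mu> (A (1 / Suc n)) + 1 / Suc n < \<delta>"
        by (meson eventually_sequentially order_refl)
      then show ?thesis by (intro exI[of _ n]) linarith
    qed
    then obtain n where n: "\<And>\<mu>. \<mu> \<in> N \<Longrightarrow> measure \<mu> (A (1 / Suc (n \<mu>))) < \<delta> - 1 / Suc (n \<mu>)"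
      by metis
    define \<eta> where "\<eta> = Min (insert 1 ((\<lambda>\<mu>. 1 / real (Suc (n \<mu>))) ` N))"
    have \<eta>: "\<eta> > 0" using N by (auto simp: \<eta>_def)
    have \<eta>_le: "\<eta> \<le> 1 / Suc (n \<mu>)" if "\<mu> \<in> N" for \<mu> using N that by (auto simp: \<eta>_def)
    have "basic_nbhd d Y g N \<eta> \<eta> \<subseteq> W f N \<epsilon> \<delta>"
    proof
      fix h assume h: "h \<in> basic_nbhd d Y g N \<eta> \<eta>"
      then have hF: "h \<in> ?F" by (simp add: basic_nbhd_def)
      have "measure \<mu> {y \<in> space Y. d (f y) (h y) \<ge> \<epsilon>} < \<delta>" if \<mu>: "\<mu> \<in> N" for \<mu>
      proof -
        have \<mu>': "\<mu> \<in> borel_probabilities Y" using \<mu> N by auto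
        interpret prob_space \<mu> using \<mu>' by (rule borel_probabilitiesD)
        let ?B = "{y \<in> space Y. d (g y) (h y) > \<eta>}"
        have sets: "A r \<in> sets \<mu>" "?B \<in> sets \<mu>" for r
          unfolding A_def by (rule sets_metric_ge[OF d \<mu>' f gF] sets_metric_gt[OF d \<mu>' gF hF])+
        have "{y \<in> space Y. d (f y) (h y) \<ge> \<epsilon>} \<subseteq> A (1 / Suc (n \<mu>)) \<union> ?B"
        proof
          fix y assume y: "y \<in> {y \<in> space Y. d (f y) (h y) \<ge> \<epsilon>}"
          have "d (f y) (h y) \<le> d (f y) (g y) + d (g y) (h y)" by (rule triangle) auto
          with y \<eta>_le[OF \<mu>] show "y \<in> A (1 / Suc (n \<mu>)) \<union> ?B" unfolding A_def by force
        qed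
        then have "measure \<mu> {y \<in> space Y. d (f y) (h y) \<ge> \<epsilon>} \<le> measure \<mu> (A (1 / Suc (n \<mu>)) \<union> ?B)"
          using sets by (intro finite_measure_mono) auto
        also have "\<dots> \<le> measure \<mu> (A (1 / Suc (n \<mu>))) + measure \<mu> ?B"
          using sets by (intro measure_Un_le)
        also have "\<dots> < \<delta>"
        proof -
          have "measure \<mu> ?B < \<eta>" using h \<mu> by (simp add: basic_nbhd_def)
          then show ?thesis using n[OF \<mu>] \<eta>_le[OF \<mu>] by linarith
        qed
        finally show ?thesis .
      qed
      then show "h \<in> W f N \<epsilon> \<delta>" using hF by (simp add: W_def)
    qed
    then show "\<exists>N' \<epsilon>' \<delta>'. finite N' \<and> N' \<subseteq> borel_probabilities Y \<and> \<epsilon>' > 0 \<and> \<delta>' > 0 \<and>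
        basic_nbhd d Y g N' \<epsilon>' \<delta>' \<subseteq> W f N \<epsilon> \<delta>"
      using N \<eta> by blast
  qed
  have W_sub: "W f N \<epsilon> \<delta> \<subseteq> basic_nbhd d Y f N \<epsilon> \<delta>" and W_mem: "\<epsilon> > 0 \<Longrightarrow> \<delta> > 0 \<Longrightarrow> f \<in> W f N \<epsilon> \<delta>"
    if f: "f \<in> ?F" and N: "N \<subseteq> borel_probabilities Y" for f N \<epsilon> \<delta>
  proof -
    show "W f N \<epsilon> \<delta> \<subseteq> basic_nbhd d Y f N \<epsilon> \<delta>"
    proof
      fix g assume g: "g \<in> W f N \<epsilon> \<delta>"
      then have gF: "g \<in> ?F" by (simp add: W_def)
      have "measure \<mu> {y \<in> space Y. d (f y) (g y) > \<epsilon>} < \<delta>" if \<mu>: "\<mu> \<in> N" for \<mu>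
      proof -
        have \<mu>': "\<mu> \<in> borel_probabilities Y" using \<mu> N by auto
        interpret prob_space \<mu> using \<mu>' by (rule borel_probabilitiesD)
        have "measure \<mu> {y \<in> space Y. d (f y) (g y) > \<epsilon>} \<le> measure \<mu> {y \<in> space Y. d (f y) (g y) \<ge> \<epsilon>}"
          by (intro finite_measure_mono sets_metric_ge[OF d \<mu>' f gF]) auto
        also have "\<dots> < \<delta>" using g \<mu> by (simp add: W_def)
        finally show ?thesis .
      qed
      then show "g \<in> basic_nbhd d Y f N \<epsilon> \<delta>" using gF by (simp add: basic_nbhd_def)
    qed
    show "f \<in> W f N \<epsilon> \<delta>" if "\<epsilon> > 0" "\<delta> > 0"
    proof -
      have "{y \<in> space Y. d (f y) (f y) \<ge> \<epsilon>} = {}" using that by auto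
      then show ?thesis using f that by (simp add: W_def)
    qed
  qed
  show ?thesis
    unfolding openin_topology_base_unique
  proof (intro conjI allI impI)
    fix U f assume U: "openin (measure_topology d Y) U \<and> f \<in> U"
    then have f: "f \<in> ?F" by (auto simp: openin_measure_topology[OF d])
    from U obtain N \<epsilon> \<delta> where N: "finite N" "N \<subseteq> borel_probabilities Y" "\<epsilon> > 0" "\<delta> > 0"
        "basic_nbhd d Y f N \<epsilon> \<delta> \<subseteq> U"
      unfolding openin_measure_topology[OF d] by meson
    have "f \<in> W f N \<epsilon> \<delta>" "W f N \<epsilon> \<delta> \<subseteq> U" using W_mem[OF f N(2-4)] W_sub[OF f N(2)] N(5) by blast+
    then show "\<exists>V. (\<exists>f N \<epsilon> \<delta>. f \<in> ?F \<and> finite N \<and> N \<subseteq> borel_probabilities Y \<and> \<epsilon> > 0 \<and> \<delta> > 0 \<and>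
        V = W f N \<epsilon> \<delta>) \<and> f \<in> V \<and> V \<subseteq> U"
      using f N by blast
  qed (use W_open in blast)
qed

end

theory Submission
  imports Defs
begin

text \<open>Evaluation at a point is continuous for \<open>\<T>\<close> (use Dirac measures), so the cocycle identities
  define a closed set; translation invariance of the metric makes \<open>\<F>(Y, G)\<close> a topological group.
  Separability does not pass to subspaces here, and this is where hyperfiniteness enters: on the orbit
  relation of a finite subgroup \<open>\<Gamma>\<^sub>n\<close> of the full group a cocycle is a coboundary, because a finite
  Borel equivalence relation has a Borel selector. Every cocycle is therefore a pointwise limit of
  coboundaries of functions on \<open>X\<close>, hence a limit for \<open>\<T>\<close>. The coboundary map is continuous
  on \<open>\<F>(X, G)\<close>, which is separable: a countable set of functions that are simple over a countable
  generating family of sets is dense for all measures simultaneously.\<close>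

section \<open>The topology of convergence in every measure\<close>

text \<open>The topology tests against all probability measures at once and need not be first
  countable when \<open>Y\<close> is uncountable. Continuity is therefore proved along arbitrary
  filters (\<open>atin\<close>), while new members of a closure come from continuous maps or from
  pointwise convergent sequences: such a sequence converges in measure for every measure, so no
  estimate ever has to be tuned to a particular finite family of measures. The second obstacle is
  that the finite groups witnessing hyperfiniteness lie in the full group, not in \<Gamma>. Their
  elements agree with elements of \<Gamma> only piecewise, and a cocycle cannot be evaluated on
  them. Only their finite orbits enter; freeness translates back, since two points of one
  \<Gamma>-orbit are joined by a single element of \<Gamma>, so that the cocycle assigns a
  well-defined value to the pair.\<close>

lemma borel_measurable_topological_uminus [measurable (raw)]:
  fixes f :: "'y \<Rightarrow> 'g::{topological_group_add, second_countable_topology}"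
  assumes "f \<in> borel_measurable Y"
  shows "(\<lambda>y. - f y) \<in> borel_measurable Y"
  by (rule measurable_compose[OF assms]) (intro borel_measurable_continuous_onI continuous_intros)

lemma borel_measurable_topological_diff [measurable (raw)]:
  fixes f g :: "'y \<Rightarrow> 'g::{topological_group_add, second_countable_topology}"
  assumes "f \<in> borel_measurable Y" "g \<in> borel_measurable Y"
  shows "(\<lambda>y. f y - g y) \<in> borel_measurable Y"
  using borel_measurable_add[OF assms(1) borel_measurable_topological_uminus[OF assms(2)]] by simp

text \<open>The tail unions of \<open>A\<close> decrease to the limsup, which \<open>ev\<close>
  makes empty; continuity from above of a finite measure finishes. This is the passage from
  pointwise convergence to convergence in measure.\<close>

lemma measure_tendsto_0_eventually_notin:
  assumes "finite_measure M" and A: "\<And>n. A n \<in> sets M"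
    and ev: "\<And>x. x \<in> space M \<Longrightarrow> \<forall>\<^sub>F n in sequentially. x \<notin> A n"
  shows "(\<lambda>n. measure M (A n)) \<longlonglongrightarrow> 0"
proof -
  interpret finite_measure M by fact
  let ?B = "\<lambda>n. \<Union>m\<in>{n..}. A m"
  have "(\<Inter>n. ?B n) = {}"
  proof safe
    fix x assume x: "x \<in> (\<Inter>n. ?B n)"
    then have "x \<in> space M" using A sets.sets_into_space by blast
    from ev[OF this] x show "x \<in> {}" by (auto simp: eventually_sequentially)
  qed
  moreover have "decseq ?B" unfolding decseq_def by (intro allI impI UN_mono) auto
  then have "(\<lambda>n. measure M (?B n)) \<longlonglongrightarrow> measure M (\<Inter>n. ?B n)"
    using A by (intro finite_Lim_measure_decseq) auto
  ultimately have lim: "(\<lambda>n. measure M (?B n)) \<longlonglongrightarrow> 0" by simp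
  have "measure M (A n) \<le> measure M (?B n)" for n
    using A by (intro finite_measure_mono) auto
  then show ?thesis
    by (intro tendsto_sandwich[OF _ _ tendsto_const lim] always_eventually allI) auto
qed

lemma mem_borel_functions:
  "f \<in> carrier (borel_functions Y) \<longleftrightarrow> f \<in> borel_measurable Y \<and> f \<in> extensional (space Y)"
  by (simp add: borel_functions_def)

lemma restrict_mem_borel_functions [simp]:
  "restrict f (space Y) \<in> carrier (borel_functions Y) \<longleftrightarrow> f \<in> borel_measurable Y"
  by (simp add: mem_borel_functions measurable_restrict_self_iff)

context
  fixes d :: "'g::{topological_ab_group_add, second_countable_topology} \<Rightarrow> 'g \<Rightarrow> real"
  assumes d: "invariant_compatible_metric d"
begin

lemma invariant_metric_space: "Metric_space UNIV d"
  using d by (simp add: invariant_compatible_metric_def)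

lemma invariant_metric_topology: "Metric_space.mtopology UNIV d = euclidean"
  using d by (simp add: invariant_compatible_metric_def)

interpretation Metric_space UNIV d by (rule invariant_metric_space)

text \<open>Translation by \<open>a + b\<close> carries \<open>- a\<close> and \<open>- b\<close> to
  \<open>b\<close> and \<open>a\<close>; symmetry of the metric does the rest.\<close>

lemma invariant_metric_minus: "d (- a) (- b) = d a b"
proof -
  have "d (- a + (a + b)) (- b + (a + b)) = d (- a) (- b)"
    using d unfolding invariant_compatible_metric_def by blast
  then show ?thesis by (simp add: commute)
qed

lemma invariant_metric_add_le: "d (a + b) (a' + b') \<le> d a a' + d b b'"
proof -
  have "d (a + b) (a' + b') \<le> d (a + b) (a' + b) + d (a' + b) (a' + b')" by (rule triangle) auto
  then show ?thesis using d by (simp add: invariant_compatible_metric_def)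
qed

lemma invariant_metric_diff_le: "d (a - b) (a' - b') \<le> d a a' + d b b'"
  using invariant_metric_add_le[of a "- b" a' "- b'"] by (simp add: invariant_metric_minus)

lemma invariant_metric_tendsto:
  "(f \<longlongrightarrow> l) F \<longleftrightarrow> (\<forall>\<epsilon>>0. \<forall>\<^sub>F i in F. d (f i) l < \<epsilon>)"
  using limitin_metric[of f l F] by (simp add: invariant_metric_topology)

text \<open>The sets \<open>basic_nbhd\<close> need not be open. The variant with a non-strict
  inequality is open, still contains \<open>f\<close>, and is smaller, so it serves as the open
  witness.\<close>

lemma basic_nbhd_interior:
  assumes "f \<in> carrier (borel_functions Y)" "finite N" "N \<subseteq> borel_probabilities Y" "\<epsilon> > 0" "\<delta> > 0"
  obtains U where "openin (measure_topology d Y) U" "f \<in> U" "U \<subseteq> basic_nbhd d Y f N \<epsilon> \<delta>"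
proof
  let ?W = "{g \<in> carrier (borel_functions Y). \<forall>\<mu>\<in>N. measure \<mu> {y \<in> space Y. d (f y) (g y) \<ge> \<epsilon>} < \<delta>}"
  show "openin (measure_topology d Y) ?W"
    using base_measure_topology[OF d, unfolded openin_topology_base_unique, THEN conjunct1] assms by blast
  have "{y \<in> space Y. d (f y) (f y) \<ge> \<epsilon>} = {}" using assms(4) by auto
  then show "f \<in> ?W" using assms by simp
  show "?W \<subseteq> basic_nbhd d Y f N \<epsilon> \<delta>"
  proof
    fix g assume g: "g \<in> ?W"
    have "measure \<mu> {y \<in> space Y. d (f y) (g y) > \<epsilon>} < \<delta>" if \<mu>: "\<mu> \<in> N" for \<mu>
    proof -
      have \<mu>': "\<mu> \<in> borel_probabilities Y" using \<mu> assms by auto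
      interpret prob_space \<mu> using \<mu>' by (rule borel_probabilitiesD)
      have "measure \<mu> {y \<in> space Y. d (f y) (g y) > \<epsilon>} \<le> measure \<mu> {y \<in> space Y. d (f y) (g y) \<ge> \<epsilon>}"
        using g by (intro finite_measure_mono sets_metric_ge[OF d \<mu>' assms(1)]) auto
      also have "\<dots> < \<delta>" using g \<mu> by simp
      finally show ?thesis .
    qed
    then show "g \<in> basic_nbhd d Y f N \<epsilon> \<delta>" using g by (simp add: basic_nbhd_def)
  qed
qed

text \<open>A neighbourhood constrains finitely many measures only, and finitely many eventual
  statements hold eventually together; so convergence may be tested one measure at a time. The
  filter is arbitrary because continuity cannot be reduced to sequences here.\<close>

lemma limitin_measure_topology:
  "limitin (measure_topology d Y) f l F \<longleftrightarrow>
     l \<in> carrier (borel_functions Y) \<and> (\<forall>\<^sub>F i in F. f i \<in> carrier (borel_functions Y)) \<and>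
     (\<forall>\<mu>\<in>borel_probabilities Y. \<forall>\<epsilon>>0.
        ((\<lambda>i. measure \<mu> {y \<in> space Y. d (l y) (f i y) > \<epsilon>}) \<longlongrightarrow> 0) F)"
  (is "?lhs \<longleftrightarrow> ?rhs")
proof
  assume lim: ?lhs
  then have l: "l \<in> carrier (borel_functions Y)"
    by (metis limitin_topspace topspace_measure_topology[OF d])
  have f: "\<forall>\<^sub>F i in F. f i \<in> carrier (borel_functions Y)"
    using lim l openin_topspace[of "measure_topology d Y"]
    unfolding limitin_def topspace_measure_topology[OF d] by blast
  have "((\<lambda>i. measure \<mu> {y \<in> space Y. d (l y) (f i y) > \<epsilon>}) \<longlongrightarrow> 0) F"
    if \<mu>: "\<mu> \<in> borel_probabilities Y" and \<epsilon>: "\<epsilon> > 0" for \<mu> \<epsilon>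
  proof (rule tendstoI)
    fix \<delta> :: real assume "\<delta> > 0"
    with \<mu> \<epsilon> have *: "finite {\<mu>}" "{\<mu>} \<subseteq> borel_probabilities Y" "\<epsilon> > 0" "\<delta> > 0" by auto
    obtain U where U: "openin (measure_topology d Y) U" "l \<in> U" "U \<subseteq> basic_nbhd d Y l {\<mu>} \<epsilon> \<delta>"
      by (rule basic_nbhd_interior[OF l *])
    then have "\<forall>\<^sub>F i in F. f i \<in> U" using lim unfolding limitin_def by blast
    then show "\<forall>\<^sub>F i in F. dist (measure \<mu> {y \<in> space Y. d (l y) (f i y) > \<epsilon>}) 0 < \<delta>"
      by eventually_elim (use U(3) in \<open>auto simp: basic_nbhd_def\<close>)
  qed
  then show ?rhs using l f by blast
next
  assume R: ?rhs
  show ?lhs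
    unfolding limitin_def topspace_measure_topology[OF d]
  proof (intro conjI allI impI)
    fix U assume U: "openin (measure_topology d Y) U \<and> l \<in> U"
    then obtain N \<epsilon> \<delta> where N: "finite N" "N \<subseteq> borel_probabilities Y" "\<epsilon> > 0" "\<delta> > 0"
        "basic_nbhd d Y l N \<epsilon> \<delta> \<subseteq> U"
      unfolding openin_measure_topology[OF d] by meson
    have "\<forall>\<^sub>F i in F. measure \<mu> {y \<in> space Y. d (l y) (f i y) > \<epsilon>} < \<delta>" if "\<mu> \<in> N" for \<mu>
    proof (rule order_tendstoD(2)[OF _ N(4)])
      show "((\<lambda>i. measure \<mu> {y \<in> space Y. d (l y) (f i y) > \<epsilon>}) \<longlongrightarrow> 0) F" using R N that by blast
    qed
    then have "\<forall>\<^sub>F i in F. \<forall>\<mu>\<in>N. measure \<mu> {y \<in> space Y. d (l y) (f i y) > \<epsilon>} < \<delta>"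
      by (intro eventually_ball_finite[OF N(1)]) blast
    moreover have "\<forall>\<^sub>F i in F. f i \<in> carrier (borel_functions Y)" using R by blast
    ultimately show "\<forall>\<^sub>F i in F. f i \<in> U"
      by eventually_elim (use N(5) in \<open>auto simp: basic_nbhd_def\<close>)
  qed (use R in blast)
qed

text \<open>Restricted to sequences, since countable additivity is used; for nets the claim fails.
  The hypotheses mention no measure, which gives the limit in all measures simultaneously.\<close>

lemma limitin_measure_topology_pointwise:
  assumes f: "\<And>n. f n \<in> carrier (borel_functions Y)" and l: "l \<in> carrier (borel_functions Y)"
    and lim: "\<And>y. y \<in> space Y \<Longrightarrow> (\<lambda>n. f n y) \<longlonglongrightarrow> l y"
  shows "limitin (measure_topology d Y) f l sequentially"
  unfolding limitin_measure_topology
proof (intro conjI ballI allI impI)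
  fix \<mu> and \<epsilon> :: real assume \<mu>: "\<mu> \<in> borel_probabilities Y" and \<epsilon>: "\<epsilon> > 0"
  interpret prob_space \<mu> using \<mu> by (rule borel_probabilitiesD)
  show "(\<lambda>n. measure \<mu> {y \<in> space Y. d (l y) (f n y) > \<epsilon>}) \<longlonglongrightarrow> 0"
  proof (rule measure_tendsto_0_eventually_notin)
    show "{y \<in> space Y. d (l y) (f n y) > \<epsilon>} \<in> sets \<mu>" for n
      by (rule sets_metric_gt[OF d \<mu> l f])
    fix y assume "y \<in> space \<mu>"
    then have "(\<lambda>n. f n y) \<longlonglongrightarrow> l y" using lim borel_probabilitiesD(3)[OF \<mu>] by simp
    then have "\<forall>\<^sub>F n in sequentially. d (f n y) (l y) < \<epsilon>"
      unfolding invariant_metric_tendsto using \<epsilon> by blast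
    then show "\<forall>\<^sub>F n in sequentially. y \<notin> {y \<in> space Y. d (l y) (f n y) > \<epsilon>}"
      by eventually_elim (auto simp: commute)
  qed unfold_locales
qed (use f l in auto)

lemma continuous_map_eval:
  assumes y: "y \<in> space Y"
  shows "continuous_map (measure_topology d Y) euclidean (\<lambda>f. f y)"
  unfolding continuous_map_atin
proof
  let ?T = "measure_topology d Y" and ?\<mu> = "return Y y"
  fix l assume l': "l \<in> topspace ?T"
  then have l: "l \<in> carrier (borel_functions Y)" by (simp add: topspace_measure_topology[OF d])
  let ?F = "atin ?T l"
  have \<mu>: "?\<mu> \<in> borel_probabilities Y"
    using prob_space_return[OF y] by (simp add: borel_probabilities_def)
  have "limitin ?T (\<lambda>f. f) l ?F" using l' by (simp add: limitin_continuous_map)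
  then have ev: "\<forall>\<^sub>F f in ?F. f \<in> carrier (borel_functions Y)"
    and lim: "\<And>\<epsilon>. \<epsilon> > 0 \<Longrightarrow> ((\<lambda>f. measure ?\<mu> {y \<in> space Y. d (l y) (f y) > \<epsilon>}) \<longlongrightarrow> 0) ?F"
    unfolding limitin_measure_topology using \<mu> by blast+
  have "((\<lambda>f. f y) \<longlongrightarrow> l y) ?F"
    unfolding invariant_metric_tendsto
  proof (intro allI impI)
    \<comment> \<open>A Dirac measure takes only the values 0 and 1, so measure below 1 means that
      the point is not in the bad set. The threshold \<open>\<epsilon> / 2\<close> turns the
      resulting non-strict bound into a strict one.\<close>
    fix \<epsilon> :: real assume \<epsilon>: "\<epsilon> > 0"
    have "\<forall>\<^sub>F f in ?F. measure ?\<mu> {y \<in> space Y. d (l y) (f y) > \<epsilon> / 2} < 1"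
      using lim[of "\<epsilon> / 2"] \<epsilon> by (intro order_tendstoD(2)) auto
    with ev show "\<forall>\<^sub>F f in ?F. d (f y) (l y) < \<epsilon>"
    proof eventually_elim
      case (elim f)
      have "{y \<in> space Y. d (l y) (f y) > \<epsilon> / 2} \<in> sets Y"
        using sets_metric_gt[OF d \<mu> l elim(1), of "\<epsilon> / 2"] by (simp del: divide_less_eq)
      with elim(2) y \<epsilon> show ?case
        by (auto simp: measure_return commute indicator_def split: if_splits)
    qed
  qed
  then show "limitin euclidean (\<lambda>f. f y) (l y) ?F" by simp
qed

text \<open>If the values of \<open>h\<close> differ by more than \<epsilon>, then one of the two
  arguments has moved by more than \<open>\<epsilon> / 2\<close>. Letting \<open>h\<close> depend on
  the point \<open>y\<close> makes one lemma cover addition, negation, subtraction and the pasting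
  of two functions along a Borel set.\<close>

lemma continuous_map_nonexpansive:
  assumes meas: "\<And>f g. f \<in> borel_measurable Y \<Longrightarrow> g \<in> borel_measurable Y \<Longrightarrow>
      (\<lambda>y. h y (f y) (g y)) \<in> borel_measurable Y"
    and le: "\<And>y a a' b b'. d (h y a b) (h y a' b') \<le> d a a' + d b b'"
  shows "continuous_map (prod_topology (measure_topology d Y) (measure_topology d Y))
    (measure_topology d Y) (\<lambda>(f, g). \<lambda>y\<in>space Y. h y (f y) (g y))"
  unfolding continuous_map_atin
proof
  let ?T = "measure_topology d Y"
  fix p assume p': "p \<in> topspace (prod_topology ?T ?T)"
  obtain l m where p: "p = (l, m)" by fastforce
  have lm: "l \<in> carrier (borel_functions Y)" "m \<in> carrier (borel_functions Y)"
    using p' by (auto simp: p topspace_measure_topology[OF d])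
  let ?F = "atin (prod_topology ?T ?T) p"
  let ?h = "\<lambda>(f, g). \<lambda>y\<in>space Y. h y (f y) (g y)"
  have "limitin ?T fst l ?F" "limitin ?T snd m ?F"
    using limitin_continuous_map[OF continuous_map_fst p'] limitin_continuous_map[OF continuous_map_snd p']
    by (auto simp: p)
  then have ev: "\<forall>\<^sub>F q in ?F. fst q \<in> carrier (borel_functions Y)" "\<forall>\<^sub>F q in ?F. snd q \<in> carrier (borel_functions Y)"
    and lim: "\<And>\<mu> \<epsilon>. \<mu> \<in> borel_probabilities Y \<Longrightarrow> \<epsilon> > 0 \<Longrightarrow>
      ((\<lambda>q. measure \<mu> {y \<in> space Y. d (l y) (fst q y) > \<epsilon>}) \<longlongrightarrow> 0) ?F"
      "\<And>\<mu> \<epsilon>. \<mu> \<in> borel_probabilities Y \<Longrightarrow> \<epsilon> > 0 \<Longrightarrow>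
      ((\<lambda>q. measure \<mu> {y \<in> space Y. d (m y) (snd q y) > \<epsilon>}) \<longlongrightarrow> 0) ?F"
    unfolding limitin_measure_topology by blast+
  have hF: "?h (f, g) \<in> carrier (borel_functions Y)"
    if "f \<in> carrier (borel_functions Y)" "g \<in> carrier (borel_functions Y)" for f g
    using that by (simp add: meas mem_borel_functions[of f] mem_borel_functions[of g])
  show "limitin ?T ?h (?h p) ?F"
    unfolding limitin_measure_topology
  proof (intro conjI ballI allI impI)
    show "?h p \<in> carrier (borel_functions Y)" unfolding p by (rule hF[OF lm])
    show "\<forall>\<^sub>F q in ?F. ?h q \<in> carrier (borel_functions Y)"
      using ev by eventually_elim (use hF in \<open>simp add: case_prod_unfold\<close>)
    fix \<mu> and \<epsilon> :: real assume \<mu>: "\<mu> \<in> borel_probabilities Y" and \<epsilon>: "\<epsilon> > 0"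
    interpret prob_space \<mu> using \<mu> by (rule borel_probabilitiesD)
    let ?A = "\<lambda>q. {y \<in> space Y. d (l y) (fst q y) > \<epsilon> / 2}"
    let ?B = "\<lambda>q. {y \<in> space Y. d (m y) (snd q y) > \<epsilon> / 2}"
    let ?C = "\<lambda>q. {y \<in> space Y. d (?h p y) (?h q y) > \<epsilon>}"
    have lim0: "((\<lambda>q. measure \<mu> (?A q) + measure \<mu> (?B q)) \<longlongrightarrow> 0) ?F"
      using \<epsilon> by (intro tendsto_add_zero lim \<mu>) auto
    have ev_le: "\<forall>\<^sub>F q in ?F. measure \<mu> (?C q) \<le> measure \<mu> (?A q) + measure \<mu> (?B q)"
      using ev
    proof eventually_elim
      case (elim q)
      have sets: "?A q \<in> sets \<mu>" "?B q \<in> sets \<mu>"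
        by (rule sets_metric_gt[OF d \<mu> lm(1) elim(1)] sets_metric_gt[OF d \<mu> lm(2) elim(2)])+
      have "?C q \<subseteq> ?A q \<union> ?B q"
      proof
        fix y assume y: "y \<in> ?C q"
        have "d (h y (l y) (m y)) (h y (fst q y) (snd q y)) \<le> d (l y) (fst q y) + d (m y) (snd q y)"
          by (rule le)
        with y show "y \<in> ?A q \<union> ?B q" by (auto simp: p case_prod_unfold)
      qed
      then have "measure \<mu> (?C q) \<le> measure \<mu> (?A q \<union> ?B q)"
        using sets by (intro finite_measure_mono) auto
      also have "\<dots> \<le> measure \<mu> (?A q) + measure \<mu> (?B q)" using sets by (intro measure_Un_le)
      finally show ?case .
    qed
    show "((\<lambda>q. measure \<mu> (?C q)) \<longlongrightarrow> 0) ?F"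
      by (rule tendsto_sandwich[OF _ ev_le tendsto_const lim0]) simp
  qed
qed

text \<open>The bad set upstairs is the preimage of the bad set downstairs, so its measure is that
  of the image measure \<open>distr \<mu> X p\<close>. This is again one of the measures tested by
  the topology on \<open>X\<close>, so \<open>p\<close> may be any measurable map.\<close>

lemma continuous_map_pullback:
  assumes p: "p \<in> Y \<rightarrow>\<^sub>M X"
  shows "continuous_map (measure_topology d X) (measure_topology d Y) (\<lambda>f. \<lambda>y\<in>space Y. f (p y))"
  unfolding continuous_map_atin
proof
  let ?T = "measure_topology d X" and ?h = "\<lambda>f. \<lambda>y\<in>space Y. f (p y)"
  fix l assume l': "l \<in> topspace ?T"
  then have l: "l \<in> carrier (borel_functions X)" by (simp add: topspace_measure_topology[OF d])
  let ?F = "atin ?T l"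
  have "limitin ?T (\<lambda>f. f) l ?F" using l' by (simp add: limitin_continuous_map)
  then have ev: "\<forall>\<^sub>F f in ?F. f \<in> carrier (borel_functions X)"
    and lim: "\<And>\<mu> \<epsilon>. \<mu> \<in> borel_probabilities X \<Longrightarrow> \<epsilon> > 0 \<Longrightarrow>
      ((\<lambda>f. measure \<mu> {x \<in> space X. d (l x) (f x) > \<epsilon>}) \<longlongrightarrow> 0) ?F"
    unfolding limitin_measure_topology by blast+
  have hF: "?h f \<in> carrier (borel_functions Y)" if "f \<in> carrier (borel_functions X)" for f
    using that measurable_compose[OF p, of f borel] by (simp add: mem_borel_functions[of f])
  show "limitin (measure_topology d Y) ?h (?h l) ?F"
    unfolding limitin_measure_topology
  proof (intro conjI ballI allI impI)
    show "?h l \<in> carrier (borel_functions Y)" by (rule hF[OF l])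
    show "\<forall>\<^sub>F f in ?F. ?h f \<in> carrier (borel_functions Y)"
      using ev by eventually_elim (rule hF)
    fix \<mu> and \<epsilon> :: real assume \<mu>: "\<mu> \<in> borel_probabilities Y" and \<epsilon>: "\<epsilon> > 0"
    interpret prob_space \<mu> using \<mu> by (rule borel_probabilitiesD)
    have p\<mu>: "p \<in> \<mu> \<rightarrow>\<^sub>M X"
      using p measurable_cong_sets[OF borel_probabilitiesD(2)[OF \<mu>] refl] by blast
    have \<nu>: "distr \<mu> X p \<in> borel_probabilities X"
      using prob_space_distr[OF p\<mu>] by (simp add: borel_probabilities_def)
    have "\<forall>\<^sub>F f in ?F. measure (distr \<mu> X p) {x \<in> space X. d (l x) (f x) > \<epsilon>} =
        measure \<mu> {y \<in> space Y. d (?h l y) (?h f y) > \<epsilon>}"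
      using ev
    proof eventually_elim
      case (elim f)
      have "{x \<in> space X. d (l x) (f x) > \<epsilon>} \<in> sets X" using sets_metric_gt[OF d \<nu> l elim, of \<epsilon>] by simp
      then have "measure (distr \<mu> X p) {x \<in> space X. d (l x) (f x) > \<epsilon>} =
          measure \<mu> (p -` {x \<in> space X. d (l x) (f x) > \<epsilon>} \<inter> space \<mu>)"
        by (rule measure_distr[OF p\<mu>])
      also have "p -` {x \<in> space X. d (l x) (f x) > \<epsilon>} \<inter> space \<mu> =
          {y \<in> space Y. d (?h l y) (?h f y) > \<epsilon>}"
        using measurable_space[OF p] by (auto simp: borel_probabilitiesD(3)[OF \<mu>])
      finally show ?case .
    qed
    from tendsto_cong[OF this] lim[OF \<nu> \<epsilon>]
    show "((\<lambda>f. measure \<mu> {y \<in> space Y. d (?h l y) (?h f y) > \<epsilon>}) \<longlongrightarrow> 0) ?F" by blast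
  qed
qed

end

section \<open>The topological group of Borel functions\<close>

lemma group_borel_functions:
  fixes Y :: "'y measure"
  shows "group (borel_functions Y :: ('y \<Rightarrow> 'g::{topological_ab_group_add, second_countable_topology}) monoid)"
proof (rule groupI)
  let ?F = "borel_functions Y :: ('y \<Rightarrow> 'g) monoid"
  show "\<one>\<^bsub>?F\<^esub> \<in> carrier ?F" by (simp add: borel_functions_def measurable_restrict_self_iff)
  fix f :: "'y \<Rightarrow> 'g" assume f: "f \<in> carrier ?F"
  then show "\<one>\<^bsub>?F\<^esub> \<otimes>\<^bsub>?F\<^esub> f = f"
    by (auto simp: borel_functions_def fun_eq_iff extensional_def)
  show "\<exists>g\<in>carrier ?F. g \<otimes>\<^bsub>?F\<^esub> f = \<one>\<^bsub>?F\<^esub>"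
    using f by (intro bexI[of _ "\<lambda>y\<in>space Y. - f y"]) (auto simp: borel_functions_def fun_eq_iff measurable_restrict_self_iff borel_measurable_topological_uminus)
  fix g assume g: "g \<in> carrier ?F"
  show "f \<otimes>\<^bsub>?F\<^esub> g \<in> carrier ?F"
    using f g by (auto simp: borel_functions_def measurable_restrict_self_iff)
  fix h assume "h \<in> carrier ?F"
  show "f \<otimes>\<^bsub>?F\<^esub> g \<otimes>\<^bsub>?F\<^esub> h = f \<otimes>\<^bsub>?F\<^esub> (g \<otimes>\<^bsub>?F\<^esub> h)"
    by (simp add: borel_functions_def fun_eq_iff add.assoc)
qed

lemma inv_borel_functions:
  fixes f :: "'y \<Rightarrow> 'g::{topological_ab_group_add, second_countable_topology}"
  assumes "f \<in> carrier (borel_functions Y)"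
  shows "inv\<^bsub>borel_functions Y\<^esub> f = (\<lambda>y\<in>space Y. - f y)"
  by (rule group.inv_equality[OF group_borel_functions])
    (use assms in \<open>auto simp: borel_functions_def fun_eq_iff measurable_restrict_self_iff borel_measurable_topological_uminus\<close>)

lemma topological_group_borel_functions:
  fixes d :: "'g::{topological_ab_group_add, second_countable_topology} \<Rightarrow> 'g \<Rightarrow> real"
  assumes d: "invariant_compatible_metric d"
  shows "topological_group (borel_functions Y) (measure_topology d Y)"
proof -
  let ?T = "measure_topology d Y" and ?F = "borel_functions Y :: ('a \<Rightarrow> 'g) monoid"
  have top: "topspace ?T = carrier ?F" by (rule topspace_measure_topology[OF d])
  have "continuous_map (prod_topology ?T ?T) ?T (\<lambda>(f, g). \<lambda>y\<in>space Y. f y + g y)"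
    by (rule continuous_map_nonexpansive[OF d]) (simp_all add: invariant_metric_add_le[OF d])
  then have mult: "continuous_map (prod_topology ?T ?T) ?T (\<lambda>(f, g). f \<otimes>\<^bsub>?F\<^esub> g)"
    by (simp add: borel_functions_def)
  \<comment> \<open>Negation is written as a two-argument map that ignores \<open>g\<close>, to fit
    \<open>continuous_map_nonexpansive\<close>; composing with the diagonal then gives the unary
    map.\<close>
  have "continuous_map (prod_topology ?T ?T) ?T (\<lambda>(f, g). \<lambda>y\<in>space Y. - f y)"
  proof (rule continuous_map_nonexpansive[OF d])
    interpret Metric_space UNIV d by (rule invariant_metric_space[OF d])
    show "d (- a) (- a') \<le> d a a' + d b b'" for a a' b b'
      by (simp add: invariant_metric_minus[OF d])
  qed (rule borel_measurable_topological_uminus)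
  moreover have "continuous_map ?T (prod_topology ?T ?T) (\<lambda>f. (f, f))"
    by (simp add: continuous_map_paired)
  ultimately have "continuous_map ?T ?T ((\<lambda>(f, g). \<lambda>y\<in>space Y. - f y) \<circ> (\<lambda>f. (f, f)))"
    by (rule continuous_map_compose[rotated])
  then have "continuous_map ?T ?T (\<lambda>f. inv\<^bsub>?F\<^esub> f)"
    by (rule continuous_map_eq) (simp add: top inv_borel_functions)
  with mult show ?thesis
    unfolding topological_group_def using top group_borel_functions by blast
qed

lemma topological_group_subgroup:
  assumes H: "topological_group H T" and K: "subgroup K H"
  shows "topological_group (H\<lparr>carrier := K\<rparr>) (subtopology T K)"
proof -
  have grp: "group H" and top: "topspace T = carrier H" and mult: "continuous_map (prod_topology T T) T (\<lambda>(a, b). a \<otimes>\<^bsub>H\<^esub> b)"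
    and inv: "continuous_map T T (\<lambda>a. inv\<^bsub>H\<^esub> a)"
    using H unfolding topological_group_def by auto
  interpret subgroup K H by (rule K)
  have topK: "topspace (subtopology T K) = K" using subset top by auto
  have "continuous_map (prod_topology (subtopology T K) (subtopology T K)) (subtopology T K) (\<lambda>(a, b). a \<otimes>\<^bsub>H\<^esub> b)"
    using continuous_map_from_subtopology[OF mult, of "K \<times> K"]
    by (intro continuous_map_into_subtopology) (auto simp: subtopology_Times topK)
  moreover have "continuous_map (subtopology T K) (subtopology T K) (\<lambda>a. inv\<^bsub>H\<^esub> a)"
    using continuous_map_from_subtopology[OF inv, of K]
    by (intro continuous_map_into_subtopology) (auto simp: topK)
  then have "continuous_map (subtopology T K) (subtopology T K) (\<lambda>a. inv\<^bsub>H\<lparr>carrier := K\<rparr>\<^esub> a)"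
    by (rule continuous_map_eq) (simp add: topK group.m_inv_consistent[OF grp K])
  ultimately show ?thesis
    unfolding topological_group_def using subgroup_is_group[OF grp] topK by simp
qed

section \<open>Standard Borel spaces and separability\<close>

lemma separable_metrizable_imp_second_countable:
  assumes "metrizable_space T" "separable_space T"
  shows "second_countable T"
proof -
  obtain M d where M: "Metric_space M d" and T: "T = Metric_space.mtopology M d"
    using assms(1) unfolding metrizable_space_def by blast
  interpret Metric_space M d by (rule M)
  obtain C where C: "countable C" "C \<subseteq> M" "T closure_of C = M"
    using assms(2) unfolding separable_space_def by (auto simp: T)
  let ?B = "(\<lambda>(c, n). mball c (1 / real (Suc n))) ` (C \<times> (UNIV :: nat set))"
  show ?thesis
    unfolding second_countable_def
  proof (intro exI[of _ ?B] conjI ballI allI impI)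
    show "countable ?B" using C(1) by auto
    show "openin T V" if "V \<in> ?B" for V using that by (auto simp: T)
    fix U x assume U: "openin T U \<and> x \<in> U"
    then obtain r where r: "r > 0" "mball x r \<subseteq> U" and x: "x \<in> M"
      unfolding T openin_mtopology by blast
    obtain n where n: "1 / Suc n < r / 2" using nat_approx_posE[of "r / 2"] r(1) by auto
    have "x \<in> T closure_of C" using C(3) x by simp
    moreover have "openin T (mball x (1 / Suc n))" "x \<in> mball x (1 / Suc n)"
      using x by (auto simp: T)
    ultimately obtain c where c: "c \<in> C" "c \<in> mball x (1 / Suc n)"
      unfolding in_closure_of by blast
    have "mball c (1 / Suc n) \<subseteq> mball x r"
    proof
      fix y assume y: "y \<in> mball c (1 / Suc n)"
      have "d x y \<le> d x c + d c y" using x y c by (intro triangle) auto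
      with x y c n show "y \<in> mball x r" by auto
    qed
    with c r(2) x show "\<exists>V\<in>?B. x \<in> V \<and> V \<subseteq> U"
      by (intro bexI[of _ "mball c (1 / Suc n)"]) (auto simp: commute)
  qed
qed

text \<open>A countable base does both: every open set is a countable union of members, and by the
  Hausdorff property some member contains \<open>x\<close> and misses \<open>y\<close>.\<close>

lemma standard_borel_space_generator:
  assumes "standard_borel_space X"
  obtains c :: "nat \<Rightarrow> 'a set" where
    "sets X = sigma_sets (space X) (range c)"
    "\<forall>x\<in>space X. \<forall>y\<in>space X. x \<noteq> y \<longrightarrow> (\<exists>n. x \<in> c n \<and> y \<notin> c n)"
proof -
  obtain T where T: "topspace T = space X" "completely_metrizable_space T" "separable_space T"
      "sets X = sigma_sets (topspace T) {U. openin T U}"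
    using assms unfolding standard_borel_space_def by blast
  then have met: "metrizable_space T" by (simp add: completely_metrizable_imp_metrizable_space)
  then have "second_countable T"
    using T(3) by (rule separable_metrizable_imp_second_countable)
  then obtain B where B: "countable B" "\<forall>V\<in>B. openin T V"
      "\<forall>U x. openin T U \<and> x \<in> U \<longrightarrow> (\<exists>V\<in>B. x \<in> V \<and> V \<subseteq> U)"
    unfolding second_countable_def by (elim exE conjE)
  \<comment> \<open>\<open>B\<close> may be empty when the space is; adding the empty set guarantees
    that the enumeration has range exactly \<open>insert {} B\<close>.\<close>
  define c where "c = from_nat_into (insert {} B)"
  have c: "range c = insert {} B" unfolding c_def using B(1) by (intro range_from_nat_into) auto
  have c_open: "openin T (c n)" for n
    using c rangeI[of c n] B(2) by auto
  have union: "U \<in> sigma_sets (space X) (range c)" if U: "openin T U" for U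
  proof -
    have "U = \<Union>{V \<in> B. V \<subseteq> U}" using B(3) U by blast
    moreover have "\<Union>{V \<in> B. V \<subseteq> U} \<in> sigma_sets (space X) (range c)"
    proof (rule sigma_sets_UNION)
      show "countable {V \<in> B. V \<subseteq> U}" using B(1) by (rule countable_subset[rotated]) auto
    qed (auto simp: c intro: sigma_sets.Basic)
    ultimately show ?thesis by simp
  qed
  show thesis
  proof
    show "sets X = sigma_sets (space X) (range c)"
      unfolding T(4) T(1)
      by (intro equalityI sigma_sets_mono) (use union c_open in \<open>auto intro: sigma_sets.Basic\<close>)
  next
    show "\<forall>x\<in>space X. \<forall>y\<in>space X. x \<noteq> y \<longrightarrow> (\<exists>n. x \<in> c n \<and> y \<notin> c n)"
    proof (intro ballI impI)
      fix x y assume xy: "x \<in> space X" "y \<in> space X" "x \<noteq> y"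
      have "Hausdorff_space T" using met by (rule metrizable_imp_Hausdorff_space)
      then obtain U where "openin T U" "x \<in> U" "y \<notin> U"
        using xy unfolding Hausdorff_space_def T(1) by (metis disjnt_iff)
      then obtain V where "V \<in> B" "x \<in> V" "y \<notin> V" using B(3) by blast
      moreover from this have "V \<in> range c" by (simp add: c)
      ultimately show "\<exists>n. x \<in> c n \<and> y \<notin> c n" by auto
    qed
  qed
qed

text \<open>By induction the digits before \<open>n\<close> vanish, and the tail after
  \<open>n\<close> is at most half of \<open>(1/3)^n\<close>, too small to cancel a digit of modulus
  1. Base 2 would not do: there a tail can cancel the leading digit exactly.\<close>

lemma ternary_digits_unique:
  fixes e :: "nat \<Rightarrow> real"
  assumes e: "\<And>k. e k \<in> {-1, 0, 1}" and sum: "(\<Sum>k. e k * (1/3)^k) = 0"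
  shows "e n = 0"
proof (induction n rule: less_induct)
  case (less n)
  have le: "norm (e (k + m) * (1/3)^(k + m)) \<le> (1/3)^m * (1/3)^k" for k m
    using e[of "k + m"] by (auto simp: power_add)
  have geo: "summable (\<lambda>k. (1/3)^m * (1/3 :: real)^k)" for m by (intro summable_mult summable_geometric) simp
  have summ: "summable (\<lambda>k. e k * (1/3)^k)"
    using le[of _ 0] by (intro summable_comparison_test'[OF geo[of 0], of 0]) simp
  have "(\<Sum>k<Suc n. e k * (1/3)^k) = e n * (1/3)^n" using less by simp
  then have "(\<Sum>k. e (k + Suc n) * (1/3)^(k + Suc n)) = - (e n * (1/3)^n)"
    using suminf_split_initial_segment[OF summ, of "Suc n"] sum by simp
  moreover have "norm (\<Sum>k. e (k + Suc n) * (1/3)^(k + Suc n)) \<le> (\<Sum>k. (1/3)^Suc n * (1/3 :: real)^k)"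
    by (rule norm_suminf_le[OF le geo])
  moreover have "(\<Sum>k. (1/3)^Suc n * (1/3 :: real)^k) = (1/3)^n / 2"
    by (subst suminf_mult) (auto simp: suminf_geometric)
  ultimately have "norm (e n * (1/3)^n) \<le> (1/3)^n / 2" by (metis norm_minus_cancel)
  then have "\<bar>e n\<bar> * (1/3)^n \<le> (1/2) * (1/3)^n" by (simp add: abs_mult)
  then have "\<bar>e n\<bar> \<le> 1/2" by simp
  then show ?case using e[of n] by auto
qed

text \<open>Membership of a point in the separating sets \<open>c n\<close> is recorded as a ternary
  expansion with digits 0 and 1 (the Marczewski function, with values in a Cantor set). Its purpose
  is to order the points of a finite orbit in a Borel way.\<close>

lemma standard_borel_space_real_injection:
  assumes "standard_borel_space X"
  obtains \<phi> :: "'a \<Rightarrow> real" where "\<phi> \<in> borel_measurable X" "inj_on \<phi> (space X)"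
proof -
  obtain c :: "nat \<Rightarrow> 'a set" where c: "sets X = sigma_sets (space X) (range c)"
    and sep: "\<forall>x\<in>space X. \<forall>y\<in>space X. x \<noteq> y \<longrightarrow> (\<exists>n. x \<in> c n \<and> y \<notin> c n)"
    by (rule standard_borel_space_generator[OF assms])
  let ?i = "\<lambda>n x. indicator (c n) x :: real"
  have [measurable]: "c n \<in> sets X" for n unfolding c by (rule sigma_sets.Basic) simp
  have summ: "summable (\<lambda>n. ?i n x * (1/3)^n)" for x
    by (rule summable_comparison_test'[OF summable_geometric[of "1/3"], of 0]) (auto simp: indicator_def)
  show thesis
  proof
    show "(\<lambda>x. \<Sum>n. ?i n x * (1/3)^n) \<in> borel_measurable X" by measurable
    show "inj_on (\<lambda>x. \<Sum>n. ?i n x * (1/3)^n) (space X)"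
    proof (rule inj_onI, rule ccontr)
      fix x y assume xy: "x \<in> space X" "y \<in> space X" "(\<Sum>n. ?i n x * (1/3)^n) = (\<Sum>n. ?i n y * (1/3)^n)" "x \<noteq> y"
      have "(\<Sum>n. (?i n x - ?i n y) * (1/3)^n) = 0"
        using suminf_diff[OF summ[of x] summ[of y]] xy(3) by (simp add: left_diff_distrib)
      then have "?i n x - ?i n y = 0" for n
        by (intro ternary_digits_unique[of "\<lambda>n. ?i n x - ?i n y"]) (auto simp: indicator_def)
      then have "x \<in> c n \<longleftrightarrow> y \<in> c n" for n
        using indicator_eq_1_iff[of "c n" x] indicator_eq_1_iff[of "c n" y] by (metis eq_iff_diff_eq_0)
      with sep xy(1,2,4) show False by blast
    qed
  qed
qed

text \<open>Finite decision trees: an inner node asks for membership in some \<open>c n\<close>, a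
  leaf names a value \<open>q n\<close>. Having the simple functions as values of a countable syntax
  makes their countability automatic, and the constructor \<open>Ite\<close> makes them closed under
  pasting along \<open>c n\<close>.\<close>

datatype ite_tree = Const nat | Ite nat ite_tree ite_tree

instance ite_tree :: countable by countable_datatype

primrec eval_ite :: "'y measure \<Rightarrow> (nat \<Rightarrow> 'y set) \<Rightarrow> (nat \<Rightarrow> 'g) \<Rightarrow> ite_tree \<Rightarrow> 'y \<Rightarrow> 'g" where
  "eval_ite Y c q (Const n) = (\<lambda>y\<in>space Y. q n)"
| "eval_ite Y c q (Ite n s t) = (\<lambda>y\<in>space Y. if y \<in> c n then eval_ite Y c q s y else eval_ite Y c q t y)"

lemma countable_dense_sequence:
  obtains q :: "nat \<Rightarrow> 'g :: second_countable_topology" where "\<forall>U. open U \<longrightarrow> U \<noteq> {} \<longrightarrow> (\<exists>n. q n \<in> U)"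
proof -
  obtain D :: "'g set" where D: "countable D" "\<forall>U. open U \<longrightarrow> U \<noteq> {} \<longrightarrow> (\<exists>x\<in>D. x \<in> U)"
    using countable_dense_exists by (elim exE conjE)
  have "D \<noteq> {}" using D(2)[rule_format, of UNIV] by auto
  with D(1) have r: "range (from_nat_into D) = D" by simp
  have "\<exists>n. from_nat_into D n \<in> U" if U: "open U" "U \<noteq> {}" for U
  proof -
    obtain x where "x \<in> D" "x \<in> U" using D(2)[rule_format, OF U] by (elim bexE)
    then show ?thesis using r by (metis imageE)
  qed
  then show thesis by (intro that[of "from_nat_into D"] allI impI)
qed

text \<open>A good-sets argument inside the closure \<open>K\<close> of the tree functions.
  \<open>K\<close> is closed under pasting along each generator \<open>c n\<close> by continuity,
  then along every Borel set through pointwise limits, and finally every Borel function is a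
  pointwise limit of functions pasted from constants \<open>q n\<close>. No Borel set is ever
  approximated in a given measure.\<close>

lemma separable_space_measure_topology:
  fixes d :: "'g::{topological_ab_group_add, second_countable_topology} \<Rightarrow> 'g \<Rightarrow> real"
    and c :: "nat \<Rightarrow> 'y set"
  assumes d: "invariant_compatible_metric d"
    and gen: "sets Y = sigma_sets (space Y) (range c)"
  shows "separable_space (measure_topology d Y)"
proof -
  interpret Metric_space UNIV d by (rule invariant_metric_space[OF d])
  obtain q :: "nat \<Rightarrow> 'g" where q: "\<forall>U. open U \<longrightarrow> U \<noteq> {} \<longrightarrow> (\<exists>n. q n \<in> U)"
    by (rule countable_dense_sequence)
  let ?T = "measure_topology d Y" and ?F = "carrier (borel_functions Y) :: ('y \<Rightarrow> 'g) set"
  define D where "D = range (eval_ite Y c q)"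
  define K where "K = ?T closure_of D"
  define ite where "ite S f g = (\<lambda>y\<in>space Y. if y \<in> S then f y else g y)" for S :: "'y set" and f g :: "'y \<Rightarrow> 'g"
  have top: "topspace ?T = ?F" by (rule topspace_measure_topology[OF d])
  have c: "c n \<in> sets Y" for n unfolding gen by (rule sigma_sets.Basic) simp
  have ite_F: "ite S f g \<in> ?F" if "S \<in> sets Y" "f \<in> ?F" "g \<in> ?F" for S f g
    unfolding ite_def using that by (auto simp: mem_borel_functions[of f] mem_borel_functions[of g])
  have "eval_ite Y c q t \<in> ?F" for t
  proof (induction t)
    case (Ite n s t)
    then have "ite (c n) (eval_ite Y c q s) (eval_ite Y c q t) \<in> ?F" by (intro ite_F c)
    then show ?case by (simp only: eval_ite.simps ite_def)
  next
    case (Const n)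
    show ?case by (simp only: eval_ite.simps restrict_mem_borel_functions) simp
  qed
  then have DF: "D \<subseteq> ?F" by (auto simp: D_def)
  have DK: "D \<subseteq> K" unfolding K_def using DF by (intro closure_of_subset) (simp add: top)
  have KF: "K \<subseteq> ?F" unfolding K_def top[symmetric] by (rule closure_of_subset_topspace)
  have K_lim: "l \<in> K" if "\<And>n. f n \<in> K" "l \<in> ?F" "\<And>y. y \<in> space Y \<Longrightarrow> (\<lambda>n. f n y) \<longlonglongrightarrow> l y" for f l
  proof (rule limitin_closedin)
    show "limitin ?T f l sequentially"
      using that KF by (intro limitin_measure_topology_pointwise[OF d]) auto
    show "closedin ?T K" by (simp add: K_def)
  qed (use that in auto)

  \<comment> \<open>Quantifying over all of \<open>K\<close> rather than over tree functions lets
    the operation be iterated: complements merely swap \<open>f\<close> and \<open>g\<close>, and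
    finite unions become repeated pasting.\<close>
  define \<S> where "\<S> = {S \<in> sets Y. \<forall>f\<in>K. \<forall>g\<in>K. ite S f g \<in> K}"
  have gen_\<S>: "c n \<in> \<S>" for n
  proof -
    have "continuous_map (prod_topology ?T ?T) ?T (\<lambda>(f, g). ite (c n) f g)"
      unfolding ite_def
      using continuous_map_nonexpansive[OF d, where Y = Y and h = "\<lambda>y a b. if y \<in> c n then a else b"] c
      by auto
    \<comment> \<open>The closure of \<open>D \<times> D\<close> is \<open>K \<times> K\<close>, and
      pasting along \<open>c n\<close> maps \<open>D \<times> D\<close> into \<open>D\<close>;
      continuity carries this over to the closures.\<close>
    then have "(\<lambda>(f, g). ite (c n) f g) ` (prod_topology ?T ?T closure_of (D \<times> D))
        \<subseteq> ?T closure_of ((\<lambda>(f, g). ite (c n) f g) ` (D \<times> D))"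
      by (rule continuous_map_image_closure_subset)
    also have "(\<lambda>(f, g). ite (c n) f g) ` (D \<times> D) \<subseteq> D"
    proof -
      have "ite (c n) (eval_ite Y c q s) (eval_ite Y c q t) \<in> D" for s t
        unfolding D_def by (rule range_eqI[of _ _ "Ite n s t"]) (simp add: ite_def)
      then show ?thesis by (auto simp: D_def)
    qed
    then have "?T closure_of ((\<lambda>(f, g). ite (c n) f g) ` (D \<times> D)) \<subseteq> K"
      unfolding K_def by (rule closure_of_mono)
    finally show ?thesis using c by (auto simp: \<S>_def closure_of_Times K_def[symmetric])
  qed
  have sets_\<S>: "S \<in> \<S>" if "S \<in> sets Y" for S
    using that unfolding gen
  proof (induction rule: sigma_sets.induct)
    case (Basic a)
    then show ?case using gen_\<S> by auto
  next
    case Empty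
    have "ite {} f g = g" if "g \<in> K" for f g
      using that KF by (auto simp: ite_def fun_eq_iff mem_borel_functions extensional_def)
    then show ?case by (simp add: \<S>_def)
  next
    case (Compl a)
    then have "ite (space Y - a) f g = ite a g f" for f g
      by (auto simp: ite_def fun_eq_iff)
    with Compl show ?case by (auto simp: \<S>_def)
  next
    case (Union a)
    have a: "a n \<in> sets Y" "\<And>f g. f \<in> K \<Longrightarrow> g \<in> K \<Longrightarrow> ite (a n) f g \<in> K" for n
      using Union.IH[of n] by (auto simp: \<S>_def)
    have U: "(\<Union>n. a n) \<in> sets Y" using a(1) by auto
    have "ite (\<Union>n. a n) f g \<in> K" if f: "f \<in> K" and g: "g \<in> K" for f g
    proof (rule K_lim)
      let ?u = "\<lambda>n. ite (\<Union>k<n. a k) f g"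
      have "g = ite {} f g"
        using g KF by (auto simp: ite_def fun_eq_iff mem_borel_functions extensional_def)
      moreover have "?u (Suc n) = ite (a n) f (?u n)" for n
        by (auto simp: ite_def fun_eq_iff less_Suc_eq)
      \<comment> \<open>The induction starts at the empty union, where \<open>?u 0\<close> is
        \<open>g\<close>; each step overwrites by \<open>f\<close> on one more set
        \<open>a n\<close>.\<close>
      ultimately show "?u n \<in> K" for n by (induction n) (use a f g in auto)
      show "ite (\<Union>n. a n) f g \<in> ?F" using U f g KF by (intro ite_F) auto
      fix y assume y: "y \<in> space Y"
      show "(\<lambda>n. ?u n y) \<longlonglongrightarrow> ite (\<Union>n. a n) f g y"
      proof (cases "\<exists>k. y \<in> a k")
        case True
        then obtain k where k: "y \<in> a k" by blast
        have "\<forall>\<^sub>F n in sequentially. ?u n y = ite (\<Union>n. a n) f g y"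
          using eventually_gt_at_top[of k] by eventually_elim (use k y in \<open>auto simp: ite_def\<close>)
        then show ?thesis by (rule tendsto_eventually)
      qed (auto simp: ite_def)
    qed
    with U show ?case by (simp add: \<S>_def)
  qed

  have const_K: "(\<lambda>y\<in>space Y. q n) \<in> K" for n
    using DK rangeI[of "eval_ite Y c q" "Const n"] by (auto simp: D_def)
  have "f \<in> K" if f: "f \<in> ?F" for f
  proof (rule K_lim[OF _ f])
    \<comment> \<open>\<open>s n y\<close> is a point of \<open>q 0, \<dots>, q n\<close> nearest to \<open>f y\<close>.\<close>
    define s where "s = rec_nat (\<lambda>y\<in>space Y. q 0)
      (\<lambda>n g. ite {y \<in> space Y. d (q (Suc n)) (f y) < d (g y) (f y)} (\<lambda>y\<in>space Y. q (Suc n)) g)"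
    have s_Suc: "s (Suc n) =
        ite {y \<in> space Y. d (q (Suc n)) (f y) < d (s n y) (f y)} (\<lambda>y\<in>space Y. q (Suc n)) (s n)" for n
      by (simp add: s_def)
    have s_0: "s 0 = (\<lambda>y\<in>space Y. q 0)" by (simp add: s_def)
    show s_K: "s n \<in> K" for n
    proof (induction n)
      case (Suc n)
      have fm: "f \<in> borel_measurable Y" "s n \<in> borel_measurable Y"
        using f Suc KF by (auto simp: mem_borel_functions)
      have [measurable]: "(\<lambda>y. d (s n y) (f y)) \<in> borel_measurable Y" "(\<lambda>y. d (q (Suc n)) (f y)) \<in> borel_measurable Y"
        by (intro borel_measurable_metric[OF d] fm measurable_const; simp)+
      have "{y \<in> space Y. d (q (Suc n)) (f y) < d (s n y) (f y)} \<in> \<S>"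
        by (rule sets_\<S>) measurable
      then show ?case using Suc const_K unfolding s_Suc \<S>_def by blast
    qed (simp only: s_0 const_K)
    fix y assume y: "y \<in> space Y"
    \<comment> \<open>A running minimum over an enumeration of a dense set tends to distance 0: once
      some \<open>q k\<close> is within \<epsilon> of \<open>f y\<close>, all later
      \<open>s n y\<close> are too.\<close>
    have near: "d (s n y) (f y) \<le> d (q k) (f y)" if "k \<le> n" for k n
      using that
    proof (induction n)
      case (Suc n)
      have "d (s (Suc n) y) (f y) \<le> d (s n y) (f y)" "d (s (Suc n) y) (f y) \<le> d (q (Suc n)) (f y)"
        using y by (auto simp: s_Suc ite_def)
      with Suc show ?case by (cases "k = Suc n") force+
    qed (use y in \<open>simp add: s_0\<close>)
    show "(\<lambda>n. s n y) \<longlonglongrightarrow> f y"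
      unfolding invariant_metric_tendsto[OF d]
    proof (intro allI impI)
      fix \<epsilon> :: real assume \<epsilon>: "\<epsilon> > 0"
      have "open (mball (f y) \<epsilon>)" using openin_mball[of "f y" \<epsilon>] by (simp add: invariant_metric_topology[OF d])
      moreover have "f y \<in> mball (f y) \<epsilon>" using \<epsilon> by simp
      then have "mball (f y) \<epsilon> \<noteq> {}" by blast
      ultimately obtain k where "q k \<in> mball (f y) \<epsilon>" using q by blast
      then have "d (q k) (f y) < \<epsilon>" by (simp add: commute)
      then show "\<forall>\<^sub>F n in sequentially. d (s n y) (f y) < \<epsilon>"
        by (intro eventually_sequentiallyI[of k]) (rule le_less_trans[OF near])
    qed
  qed
  then have "?T closure_of D = topspace ?T" using KF by (auto simp: K_def top)
  moreover have "countable D" by (simp add: D_def)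
  ultimately show ?thesis unfolding separable_space_def using DF top by blast
qed

section \<open>Cocycles and coboundaries\<close>

lemma borel_AutD:
  assumes "\<gamma> \<in> carrier (borel_Aut X)"
  shows borel_Aut_measurable: "\<gamma> \<in> X \<rightarrow>\<^sub>M X"
    and borel_Aut_space: "x \<in> space X \<Longrightarrow> \<gamma> x \<in> space X"
proof -
  show "\<gamma> \<in> X \<rightarrow>\<^sub>M X" using assms by (simp add: borel_Aut_def)
  then show "x \<in> space X \<Longrightarrow> \<gamma> x \<in> space X" by (rule measurable_space)
qed

lemma borel_Aut_mult_apply:
  assumes "\<gamma> \<in> carrier (borel_Aut X)" "\<gamma>' \<in> carrier (borel_Aut X)" "x \<in> space X"
  shows "(\<gamma> \<otimes>\<^bsub>borel_Aut X\<^esub> \<gamma>') x = \<gamma> (\<gamma>' x)"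
  using assms by (simp add: borel_Aut_def BijGroup_def compose_def)

lemma borel_Aut_one_apply: "x \<in> space X \<Longrightarrow> \<one>\<^bsub>borel_Aut X\<^esub> x = x"
  by (simp add: borel_Aut_def BijGroup_def)

lemma borel_Aut_inv_apply:
  assumes "\<gamma> \<in> carrier (borel_Aut X)" "x \<in> space X"
  shows "(inv\<^bsub>borel_Aut X\<^esub> \<gamma>) (\<gamma> x) = x"
proof -
  interpret group "borel_Aut X" by (rule group_borel_Aut)
  show ?thesis
    using borel_Aut_mult_apply[of "inv\<^bsub>borel_Aut X\<^esub> \<gamma>" X \<gamma> x] assms by (simp add: borel_Aut_one_apply)
qed

lemma orbit_of_eq:
  assumes H: "subgroup H (borel_Aut X)" and x: "x \<in> space X" and y: "y \<in> orbit_of H x"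
  shows "orbit_of H y = orbit_of H x"
proof -
  interpret subgroup H "borel_Aut X" by (rule H)
  obtain R where R: "R \<in> H" "y = R x" using y by (auto simp: orbit_of_def)
  have "S y = (S \<otimes>\<^bsub>borel_Aut X\<^esub> R) x" if "S \<in> H" for S
    using that R x by (simp add: borel_Aut_mult_apply)
  then have "orbit_of H y \<subseteq> orbit_of H x"
    using R(1) m_closed unfolding orbit_of_def by blast
  moreover have "S x = (S \<otimes>\<^bsub>borel_Aut X\<^esub> inv\<^bsub>borel_Aut X\<^esub> R) y" if "S \<in> H" for S
    using that R x by (simp add: borel_Aut_mult_apply borel_Aut_inv_apply borel_Aut_space)
  then have "orbit_of H x \<subseteq> orbit_of H y"
    using R(1) m_closed m_inv_closed unfolding orbit_of_def by blast
  ultimately show ?thesis by blast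
qed

lemma orbit_of_refl:
  assumes "subgroup H (borel_Aut X)" "x \<in> space X"
  shows "x \<in> orbit_of H x"
proof -
  have "\<one>\<^bsub>borel_Aut X\<^esub> x \<in> orbit_of H x"
    using subgroup.one_closed[OF assms(1)] unfolding orbit_of_def by blast
  then show ?thesis by (simp add: borel_Aut_one_apply[OF assms(2)])
qed

lemma subgroup_full_group:
  assumes \<Gamma>: "subgroup \<Gamma> (borel_Aut X)"
  shows "subgroup (carrier (full_group X \<Gamma>)) (borel_Aut X)"
proof -
  interpret G: group "borel_Aut X" by (rule group_borel_Aut)
  show ?thesis
  proof (rule G.subgroupI)
    show "carrier (full_group X \<Gamma>) \<subseteq> carrier (borel_Aut X)" by (auto simp: full_group_def)
    have "\<one>\<^bsub>borel_Aut X\<^esub> \<in> carrier (full_group X \<Gamma>)"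
      using orbit_of_refl[OF \<Gamma>] by (simp add: full_group_def borel_Aut_one_apply)
    then show "carrier (full_group X \<Gamma>) \<noteq> {}" by blast
    fix R assume R: "R \<in> carrier (full_group X \<Gamma>)"
    then have R': "R \<in> carrier (borel_Aut X)" "\<And>x. x \<in> space X \<Longrightarrow> R x \<in> orbit_of \<Gamma> x"
      by (auto simp: full_group_def)
    have "(inv\<^bsub>borel_Aut X\<^esub> R) x \<in> orbit_of \<Gamma> x" if x: "x \<in> space X" for x
    proof -
      let ?y = "(inv\<^bsub>borel_Aut X\<^esub> R) x"
      have y: "?y \<in> space X" using R'(1) x by (intro borel_Aut_space[OF G.inv_closed])
      have "R ?y = x" using borel_Aut_inv_apply[OF G.inv_closed[OF R'(1)] x] R'(1) by simp
      then have "orbit_of \<Gamma> x = orbit_of \<Gamma> ?y" using orbit_of_eq[OF \<Gamma> y] R'(2)[OF y] by simp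
      then show ?thesis using orbit_of_refl[OF \<Gamma> y] by simp
    qed
    then show "inv\<^bsub>borel_Aut X\<^esub> R \<in> carrier (full_group X \<Gamma>)" using R'(1) by (simp add: full_group_def)
    fix S assume S: "S \<in> carrier (full_group X \<Gamma>)"
    have "(R \<otimes>\<^bsub>borel_Aut X\<^esub> S) x \<in> orbit_of \<Gamma> x" if x: "x \<in> space X" for x
    proof -
      have Sx: "S x \<in> space X" "S x \<in> orbit_of \<Gamma> x"
        using S x by (auto simp: full_group_def intro: borel_Aut_space)
      then have "R (S x) \<in> orbit_of \<Gamma> x" using R'(2) orbit_of_eq[OF \<Gamma> x] by blast
      then show ?thesis using S R' x by (simp add: full_group_def borel_Aut_mult_apply)
    qed
    then show "R \<otimes>\<^bsub>borel_Aut X\<^esub> S \<in> carrier (full_group X \<Gamma>)" using R S by (simp add: full_group_def)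
  qed
qed

text \<open>This makes the orbit lemmas, stated for subgroups of \<open>borel_Aut X\<close>,
  available for the finite groups supplied by hyperfiniteness.\<close>

lemma subgroup_full_group_imp_subgroup:
  assumes "subgroup \<Gamma> (borel_Aut X)" "subgroup H (full_group X \<Gamma>)"
  shows "subgroup H (borel_Aut X)"
proof (rule group.incl_subgroup[OF group_borel_Aut subgroup_full_group[OF assms(1)]])
  have "borel_Aut X\<lparr>carrier := carrier (full_group X \<Gamma>)\<rparr> = full_group X \<Gamma>"
    by (simp add: full_group_def)
  then show "subgroup H (borel_Aut X\<lparr>carrier := carrier (full_group X \<Gamma>)\<rparr>)" using assms(2) by simp
qed

text \<open>The inverse of \<gamma>' composed with \<gamma> fixes \<open>x\<close>, so freeness
  makes it the identity.\<close>

lemma acts_freelyD: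
  assumes \<Gamma>: "subgroup \<Gamma> (borel_Aut X)" and free: "acts_freely X \<Gamma>"
    and "\<gamma> \<in> \<Gamma>" "\<gamma>' \<in> \<Gamma>" "x \<in> space X" "\<gamma> x = \<gamma>' x"
  shows "\<gamma> = \<gamma>'"
proof -
  interpret G: group "borel_Aut X" by (rule group_borel_Aut)
  interpret subgroup \<Gamma> "borel_Aut X" by (rule \<Gamma>)
  let ?\<delta> = "inv\<^bsub>borel_Aut X\<^esub> \<gamma>' \<otimes>\<^bsub>borel_Aut X\<^esub> \<gamma>"
  have "?\<delta> x = x" using assms by (simp add: borel_Aut_mult_apply borel_Aut_inv_apply)
  moreover have "?\<delta> \<in> \<Gamma>" using assms by simp
  ultimately have "?\<delta> = \<one>\<^bsub>borel_Aut X\<^esub>" using free assms(5) unfolding acts_freely_def by blast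
  then show ?thesis using assms(3,4) by (metis G.inv_equality G.inv_inv G.inv_closed mem_carrier)
qed

section \<open>The closed subgroup of cocycles\<close>

lemma space_discrete_times: "space (discrete_times \<Gamma> X) = \<Gamma> \<times> space X"
  by (simp add: space_pair_measure)

lemma mem_cocycles:
  "a \<in> carrier (cocycles \<Gamma> X) \<longleftrightarrow> a \<in> carrier (borel_functions (discrete_times \<Gamma> X)) \<and>
     (\<forall>\<gamma>\<^sub>1\<in>\<Gamma>. \<forall>\<gamma>\<^sub>2\<in>\<Gamma>. \<forall>x\<in>space X. a (\<gamma>\<^sub>1 \<otimes>\<^bsub>borel_Aut X\<^esub> \<gamma>\<^sub>2, x) = a (\<gamma>\<^sub>1, \<gamma>\<^sub>2 x) + a (\<gamma>\<^sub>2, x)) \<and>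
     (\<forall>x\<in>space X. a (\<one>\<^bsub>borel_Aut X\<^esub>, x) = 0)"
  by (simp add: cocycles_def)

text \<open>Commutativity of the coefficient group is what allows the terms of two cocycle
  identities to be regrouped into one for the sum.\<close>

lemma subgroup_cocycles:
  assumes \<Gamma>: "subgroup \<Gamma> (borel_Aut X)"
  shows "subgroup (carrier (cocycles \<Gamma> X))
    (borel_functions (discrete_times \<Gamma> X) ::
      (('a \<Rightarrow> 'a) \<times> 'a \<Rightarrow> 'g::{topological_ab_group_add, second_countable_topology}) monoid)"
proof -
  interpret subgroup \<Gamma> "borel_Aut X" by (rule \<Gamma>)
  let ?Y = "discrete_times \<Gamma> X"
  let ?F = "borel_functions ?Y :: (('a \<Rightarrow> 'a) \<times> 'a \<Rightarrow> 'g) monoid"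
  interpret F: group ?F by (rule group_borel_functions)
  have in_Y: "(\<gamma>, x) \<in> space ?Y \<longleftrightarrow> \<gamma> \<in> \<Gamma> \<and> x \<in> space X" for \<gamma> x
    by (simp add: space_discrete_times)
  note in_X = borel_Aut_space[OF mem_carrier]
  have one: "\<one>\<^bsub>?F\<^esub> = (\<lambda>y\<in>space ?Y. 0)" and mult: "f \<otimes>\<^bsub>?F\<^esub> g = (\<lambda>y\<in>space ?Y. f y + g y)" for f g
    by (simp_all add: borel_functions_def)
  show ?thesis
  proof (rule F.subgroupI)
    show "carrier (cocycles \<Gamma> X) \<subseteq> carrier ?F" by (auto simp: mem_cocycles)
    have "\<one>\<^bsub>?F\<^esub> \<in> carrier (cocycles \<Gamma> X)"
      unfolding mem_cocycles using F.one_closed by (simp add: one in_Y in_X)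
    then show "carrier (cocycles \<Gamma> X :: (('a \<Rightarrow> 'a) \<times> 'a \<Rightarrow> 'g) monoid) \<noteq> {}" by blast
    fix a :: "('a \<Rightarrow> 'a) \<times> 'a \<Rightarrow> 'g" assume a: "a \<in> carrier (cocycles \<Gamma> X)"
    then show "inv\<^bsub>?F\<^esub> a \<in> carrier (cocycles \<Gamma> X)"
      unfolding mem_cocycles using F.inv_closed[of a] by (simp add: inv_borel_functions in_Y in_X)
    fix b :: "('a \<Rightarrow> 'a) \<times> 'a \<Rightarrow> 'g" assume b: "b \<in> carrier (cocycles \<Gamma> X)"
    with a show "a \<otimes>\<^bsub>?F\<^esub> b \<in> carrier (cocycles \<Gamma> X)"
      unfolding mem_cocycles using F.m_closed[of a b] by (simp add: mult in_Y in_X algebra_simps)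
  qed
qed

lemma closedin_cocycles:
  fixes d :: "'g::{topological_ab_group_add, second_countable_topology} \<Rightarrow> 'g \<Rightarrow> real"
  assumes d: "invariant_compatible_metric d" and \<Gamma>: "subgroup \<Gamma> (borel_Aut X)"
  shows "closedin (measure_topology d (discrete_times \<Gamma> X)) (carrier (cocycles \<Gamma> X))"
proof -
  interpret subgroup \<Gamma> "borel_Aut X" by (rule \<Gamma>)
  interpret Metric_space UNIV d by (rule invariant_metric_space[OF d])
  let ?T = "measure_topology d (discrete_times \<Gamma> X)"
  define E where "E \<gamma>\<^sub>1 \<gamma>\<^sub>2 x = {a \<in> topspace ?T. a (\<gamma>\<^sub>1 \<otimes>\<^bsub>borel_Aut X\<^esub> \<gamma>\<^sub>2, x) = a (\<gamma>\<^sub>1, \<gamma>\<^sub>2 x) + a (\<gamma>\<^sub>2, x)}" for \<gamma>\<^sub>1 \<gamma>\<^sub>2 x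
  define I where "I x = {a \<in> topspace ?T. a (\<one>\<^bsub>borel_Aut X\<^esub>, x) = 0}" for x
  have haus: "Hausdorff_space (euclidean :: 'g topology)"
    using Hausdorff_space_mtopology by (simp add: invariant_metric_topology[OF d])
  have eval: "continuous_map ?T euclidean (\<lambda>a. a (\<gamma>, x))" if "\<gamma> \<in> \<Gamma>" "x \<in> space X" for \<gamma> x
    using that by (intro continuous_map_eval[OF d]) (simp add: space_discrete_times)
  have "closedin ?T (E \<gamma>\<^sub>1 \<gamma>\<^sub>2 x)" if "\<gamma>\<^sub>1 \<in> \<Gamma>" "\<gamma>\<^sub>2 \<in> \<Gamma>" "x \<in> space X" for \<gamma>\<^sub>1 \<gamma>\<^sub>2 x
  proof -
    have "continuous_map ?T euclidean (\<lambda>a. a (\<gamma>\<^sub>1, \<gamma>\<^sub>2 x))" "continuous_map ?T euclidean (\<lambda>a. a (\<gamma>\<^sub>2, x))"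
      using that by (auto intro: eval borel_Aut_space[OF mem_carrier])
    then have "continuous_map ?T euclidean (\<lambda>a. a (\<gamma>\<^sub>1, \<gamma>\<^sub>2 x) + a (\<gamma>\<^sub>2, x))"
      unfolding continuous_map_atin limitin_canonical_iff by (intro ballI tendsto_add) auto
    then show ?thesis
      unfolding E_def using that by (intro closedin_continuous_maps_eq[OF haus] eval) auto
  qed
  moreover have "closedin ?T (I x)" if "x \<in> space X" for x
    unfolding I_def using that by (intro closedin_continuous_maps_eq[OF haus] eval) auto
  \<comment> \<open>The intersection is taken over a nonempty family: if \<open>space X\<close> is
    empty there are no equations, and \<open>topspace ?T\<close> alone remains.\<close>
  ultimately have "closedin ?T (\<Inter> (insert (topspace ?T)
      ((\<lambda>(\<gamma>\<^sub>1, \<gamma>\<^sub>2, x). E \<gamma>\<^sub>1 \<gamma>\<^sub>2 x) ` (\<Gamma> \<times> \<Gamma> \<times> space X) \<union> I ` space X)))"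
    (is "closedin _ ?R") by (intro closedin_Inter) auto
  moreover have "?R = carrier (cocycles \<Gamma> X)"
  proof (rule Set.set_eqI)
    fix a
    have "a \<in> ?R \<longleftrightarrow> a \<in> topspace ?T \<and> (\<forall>\<gamma>\<^sub>1\<in>\<Gamma>. \<forall>\<gamma>\<^sub>2\<in>\<Gamma>. \<forall>x\<in>space X. a \<in> E \<gamma>\<^sub>1 \<gamma>\<^sub>2 x) \<and> (\<forall>x\<in>space X. a \<in> I x)"
      by auto
    also have "\<dots> \<longleftrightarrow> a \<in> carrier (cocycles \<Gamma> X)"
      by (auto simp: E_def I_def mem_cocycles topspace_measure_topology[OF d])
    finally show "a \<in> ?R \<longleftrightarrow> a \<in> carrier (cocycles \<Gamma> X)" .
  qed
  ultimately show ?thesis by simp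
qed

section \<open>Coboundaries and their density among the cocycles\<close>

definition coboundary :: "('a \<Rightarrow> 'a) set \<Rightarrow> 'a measure \<Rightarrow> ('a \<Rightarrow> 'g::group_add) \<Rightarrow> ('a \<Rightarrow> 'a) \<times> 'a \<Rightarrow> 'g" where
  "coboundary \<Gamma> X f = (\<lambda>p\<in>space (discrete_times \<Gamma> X). f (fst p (snd p)) - f (snd p))"

text \<open>Countability of \<Gamma> reduces joint measurability to that of each single
  automorphism.\<close>

lemma measurable_action:
  assumes "countable \<Gamma>" "\<Gamma> \<subseteq> carrier (borel_Aut X)"
  shows "(\<lambda>p. fst p (snd p)) \<in> discrete_times \<Gamma> X \<rightarrow>\<^sub>M X"
  using assms by (intro measurable_pair_measure_countable1) (auto intro: borel_Aut_measurable)

text \<open>A coboundary is the difference of two pullbacks to \<Gamma> \<times> X, one along the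
  action and one along the projection; both pullbacks and the subtraction are continuous.\<close>

lemma continuous_map_coboundary:
  fixes d :: "'g::{topological_ab_group_add, second_countable_topology} \<Rightarrow> 'g \<Rightarrow> real"
  assumes d: "invariant_compatible_metric d" and \<Gamma>: "countable \<Gamma>" "\<Gamma> \<subseteq> carrier (borel_Aut X)"
  shows "continuous_map (measure_topology d X) (measure_topology d (discrete_times \<Gamma> X)) (coboundary \<Gamma> X)"
proof -
  let ?Y = "discrete_times \<Gamma> X"
  let ?S = "measure_topology d X" and ?T = "measure_topology d ?Y"
  let ?u = "\<lambda>f. \<lambda>p\<in>space ?Y. f (fst p (snd p))" and ?v = "\<lambda>f. \<lambda>p\<in>space ?Y. f (snd p)"
  let ?diff = "\<lambda>(f, g). \<lambda>p\<in>space ?Y. f p - g p"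
  have "continuous_map ?S (prod_topology ?T ?T) (\<lambda>f. (?u f, ?v f))"
    unfolding continuous_map_paired
    by (intro conjI continuous_map_pullback[OF d] measurable_action \<Gamma>) simp
  moreover have "continuous_map (prod_topology ?T ?T) ?T ?diff"
    by (rule continuous_map_nonexpansive[OF d]) (simp_all add: invariant_metric_diff_le[OF d] borel_measurable_topological_diff)
  ultimately have conv: "continuous_map ?S ?T (?diff \<circ> (\<lambda>f. (?u f, ?v f)))"
    by (rule continuous_map_compose)
  have eq: "?diff \<circ> (\<lambda>f. (?u f, ?v f)) = coboundary \<Gamma> X"
    by (auto simp: coboundary_def fun_eq_iff)
  show ?thesis using conv unfolding eq .
qed

lemma coboundary_in_cocycles:
  fixes f :: "'a \<Rightarrow> 'g::{topological_ab_group_add, second_countable_topology}"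
  assumes \<Gamma>: "subgroup \<Gamma> (borel_Aut X)" "countable \<Gamma>" and f: "f \<in> carrier (borel_functions X)"
  shows "coboundary \<Gamma> X f \<in> carrier (cocycles \<Gamma> X)"
proof -
  interpret subgroup \<Gamma> "borel_Aut X" by (rule \<Gamma>)
  have fm [measurable]: "f \<in> borel_measurable X" using f by (simp add: mem_borel_functions)
  note [measurable] = measurable_action[OF \<Gamma>(2) subset]
  have "coboundary \<Gamma> X f \<in> carrier (borel_functions (discrete_times \<Gamma> X))"
    unfolding coboundary_def restrict_mem_borel_functions
    by (intro borel_measurable_topological_diff) measurable
  then show ?thesis
    unfolding mem_cocycles coboundary_def
    by (simp add: space_discrete_times borel_Aut_space[OF mem_carrier] borel_Aut_mult_apply borel_Aut_one_apply)
qed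

text \<open>On the finite equivalence relation of \<open>H\<close> a Borel selector is provided by the point of each orbit
  that is minimal for a Borel injection of \<open>X\<close> into the reals; by freeness it is \<open>\<gamma> x\<close> for
  exactly one \<open>\<gamma> \<in> \<Gamma>\<close>, and \<open>f x = - a (\<gamma>, x)\<close> does the job.\<close>

lemma cocycle_eq_coboundary_on_finite_orbits:
  fixes a :: "('a \<Rightarrow> 'a) \<times> 'a \<Rightarrow> 'g::{topological_ab_group_add, second_countable_topology}"
  assumes X: "standard_borel_space X" and \<Gamma>: "subgroup \<Gamma> (borel_Aut X)" "countable \<Gamma>" "acts_freely X \<Gamma>"
    and H: "finite H" "subgroup H (full_group X \<Gamma>)" and a: "a \<in> carrier (cocycles \<Gamma> X)"
  obtains f where "f \<in> carrier (borel_functions X)"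
    "\<forall>\<gamma>\<in>\<Gamma>. \<forall>x\<in>space X. \<gamma> x \<in> orbit_of H x \<longrightarrow> a (\<gamma>, x) = f (\<gamma> x) - f x"
proof -
  interpret subgroup \<Gamma> "borel_Aut X" by (rule \<Gamma>)
  have H': "subgroup H (borel_Aut X)" by (rule subgroup_full_group_imp_subgroup[OF \<Gamma>(1) H(2)])
  interpret H: subgroup H "borel_Aut X" by (rule H')
  obtain \<phi> :: "'a \<Rightarrow> real" where \<phi>: "\<phi> \<in> borel_measurable X" "inj_on \<phi> (space X)"
    by (rule standard_borel_space_real_injection[OF X])
  \<comment> \<open>The minimal point is described through an element of \<Gamma> and not of
    \<open>H\<close>, because \<open>a\<close> can only be evaluated on \<Gamma>.\<close>
  define P where "P x \<gamma> \<longleftrightarrow> \<gamma> \<in> \<Gamma> \<and> \<gamma> x \<in> orbit_of H x \<and> (\<forall>z\<in>orbit_of H x. \<phi> (\<gamma> x) \<le> \<phi> z)" for x \<gamma>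
  have unique: "\<gamma> = \<gamma>'" if "x \<in> space X" "P x \<gamma>" "P x \<gamma>'" for x \<gamma> \<gamma>'
  proof (rule acts_freelyD[OF \<Gamma>(1,3)])
    have "\<phi> (\<gamma> x) = \<phi> (\<gamma>' x)" using that by (intro antisym) (auto simp: P_def)
    then show "\<gamma> x = \<gamma>' x"
      using that by (intro inj_onD[OF \<phi>(2)]) (auto simp: P_def intro: borel_Aut_space[OF mem_carrier])
  qed (use that in \<open>auto simp: P_def\<close>)
  have ex: "\<exists>\<gamma>. P x \<gamma>" if x: "x \<in> space X" for x
  proof -
    have fin: "finite (\<phi> ` orbit_of H x)" using H(1) by (simp add: orbit_of_def setcompr_eq_image)
    have "\<phi> ` orbit_of H x \<noteq> {}" using orbit_of_refl[OF H' x] by blast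
    then have "Min (\<phi> ` orbit_of H x) \<in> \<phi> ` orbit_of H x" by (rule Min_in[OF fin])
    then obtain z where z: "z \<in> orbit_of H x" "\<phi> z = Min (\<phi> ` orbit_of H x)" by auto
    obtain R where R: "R \<in> H" "z = R x" using z(1) by (auto simp: orbit_of_def)
    \<comment> \<open>Membership in the full group is what trades \<open>R\<close> for an element of
      \<Gamma> with the same value at this particular \<open>x\<close>.\<close>
    have "R \<in> carrier (full_group X \<Gamma>)" using R(1) subgroup.mem_carrier[OF H(2)] by blast
    then have "z \<in> orbit_of \<Gamma> x" using R(2) x by (simp add: full_group_def)
    then obtain \<gamma> where \<gamma>: "\<gamma> \<in> \<Gamma>" "z = \<gamma> x" by (auto simp: orbit_of_def)
    have "\<forall>w\<in>orbit_of H x. \<phi> z \<le> \<phi> w" unfolding z(2) using Min_le[OF fin] by blast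
    then show ?thesis unfolding P_def using \<gamma> z(1) by blast
  qed
  define g where "g x = (THE \<gamma>. P x \<gamma>)" for x
  have g_eq: "g x = \<gamma> \<longleftrightarrow> P x \<gamma>" if "x \<in> space X" for x \<gamma>
    using theI'[of "P x"] unique[OF that] ex[OF that] unfolding g_def by metis
  have gP: "P x (g x)" if "x \<in> space X" for x by (rule g_eq[OF that, THEN iffD1, OF refl])
  then have g\<Gamma>: "g x \<in> \<Gamma>" if "x \<in> space X" for x using that unfolding P_def by blast
  have "g \<in> X \<rightarrow>\<^sub>M count_space \<Gamma>"
    unfolding measurable_count_space_eq_countable[OF \<Gamma>(2)]
  proof (intro conjI ballI)
    show "g \<in> space X \<rightarrow> \<Gamma>" using g\<Gamma> by blast
    fix \<gamma> assume \<gamma>: "\<gamma> \<in> \<Gamma>"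
    have meas: "(\<lambda>x. \<phi> (R x)) \<in> borel_measurable X" if "R \<in> \<Gamma> \<or> R \<in> H" for R
      using that by (intro measurable_compose[OF borel_Aut_measurable \<phi>(1)]) auto
    \<comment> \<open>Injectivity of \<phi> turns membership in the orbit into an equality of reals,
      so that finitely many Borel comparisons describe the set.\<close>
    have "g -` {\<gamma>} \<inter> space X =
        {x \<in> space X. (\<exists>R\<in>H. \<phi> (\<gamma> x) = \<phi> (R x)) \<and> (\<forall>R\<in>H. \<phi> (\<gamma> x) \<le> \<phi> (R x))}"
    proof -
      have "\<gamma> x \<in> orbit_of H x \<longleftrightarrow> (\<exists>R\<in>H. \<phi> (\<gamma> x) = \<phi> (R x))" if x: "x \<in> space X" for x
        using inj_on_eq_iff[OF \<phi>(2) borel_Aut_space[OF mem_carrier[OF \<gamma>] x] borel_Aut_space[OF H.mem_carrier x]]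
        unfolding orbit_of_def by auto
      moreover have "(\<forall>z\<in>orbit_of H x. \<phi> (\<gamma> x) \<le> \<phi> z) \<longleftrightarrow> (\<forall>R\<in>H. \<phi> (\<gamma> x) \<le> \<phi> (R x))" for x
        by (auto simp: orbit_of_def)
      ultimately have "g x = \<gamma> \<longleftrightarrow> (\<exists>R\<in>H. \<phi> (\<gamma> x) = \<phi> (R x)) \<and> (\<forall>R\<in>H. \<phi> (\<gamma> x) \<le> \<phi> (R x))"
        if "x \<in> space X" for x
        using that \<gamma> by (simp add: g_eq P_def)
      then show ?thesis by blast
    qed
    also have "\<dots> \<in> sets X"
    proof -
      have "{x \<in> space X. \<phi> (\<gamma> x) = \<phi> (R x)} \<in> sets X" "{x \<in> space X. \<phi> (\<gamma> x) \<le> \<phi> (R x)} \<in> sets X"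
        if "R \<in> H" for R
        using that \<gamma> by (intro borel_measurable_eq borel_measurable_le meas; blast)+
      then show ?thesis
        using H(1)
        by (intro sets.sets_Collect_conj sets.sets_Collect_finite_Ex sets.sets_Collect_finite_All) auto
    qed
    finally show "g -` {\<gamma>} \<inter> space X \<in> sets X" .
  qed
  then have "(\<lambda>x. (g x, x)) \<in> X \<rightarrow>\<^sub>M discrete_times \<Gamma> X" by simp
  moreover have am: "a \<in> borel_measurable (discrete_times \<Gamma> X)"
    using a by (simp add: mem_cocycles mem_borel_functions)
  ultimately have "(\<lambda>x. a (g x, x)) \<in> borel_measurable X" by (rule measurable_compose)
  then have fm: "(\<lambda>x\<in>space X. - a (g x, x)) \<in> carrier (borel_functions X)" by simp
  show thesis
  proof (rule that[OF fm], intro ballI impI)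
    fix \<gamma> x assume \<gamma>: "\<gamma> \<in> \<Gamma>" and x: "x \<in> space X" and orb: "\<gamma> x \<in> orbit_of H x"
    have y: "\<gamma> x \<in> space X" using \<gamma> x by (simp add: borel_Aut_space)
    have "orbit_of H (\<gamma> x) = orbit_of H x" by (rule orbit_of_eq[OF H' x orb])
    \<comment> \<open>Since \<open>x\<close> and \<open>\<gamma> x\<close> share their
      \<open>H\<close>-orbit, they share its minimal point, and uniqueness gives \<open>g x\<close>
      as the product of \<open>g (\<gamma> x)\<close> and \<gamma>. The cocycle identity then reads
      \<open>a (g x, x) = a (g (\<gamma> x), \<gamma> x) + a (\<gamma>, x)\<close>, which is the
      claim for \<open>f x = - a (g x, x)\<close>.\<close>
    then have "P x (g (\<gamma> x) \<otimes>\<^bsub>borel_Aut X\<^esub> \<gamma>)"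
      using gP[OF y] \<gamma> x unfolding P_def by (simp add: borel_Aut_mult_apply)
    then have "g x = g (\<gamma> x) \<otimes>\<^bsub>borel_Aut X\<^esub> \<gamma>" by (simp add: g_eq[OF x])
    moreover have "a (g (\<gamma> x) \<otimes>\<^bsub>borel_Aut X\<^esub> \<gamma>, x) = a (g (\<gamma> x), \<gamma> x) + a (\<gamma>, x)"
      using a g\<Gamma>[OF y] \<gamma> x unfolding mem_cocycles by blast
    ultimately show "a (\<gamma>, x) = (\<lambda>x\<in>space X. - a (g x, x)) (\<gamma> x) - (\<lambda>x\<in>space X. - a (g x, x)) x"
      using x y by simp
  qed
qed

text \<open>At each point \<open>(\<gamma>, x)\<close> the sequence is eventually constant:
  \<open>\<gamma> x\<close> enters the orbit of \<open>x\<close> under some \<open>F i\<close> and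
  stays there because the groups increase. The index depends on the point, so the convergence is
  pointwise and need not be uniform.\<close>

lemma cocycle_limit_of_coboundaries:
  fixes d :: "'g::{topological_ab_group_add, second_countable_topology} \<Rightarrow> 'g \<Rightarrow> real"
  assumes d: "invariant_compatible_metric d" and X: "standard_borel_space X"
    and \<Gamma>: "subgroup \<Gamma> (borel_Aut X)" "countable \<Gamma>" "acts_freely X \<Gamma>" "hyperfinite X \<Gamma>"
    and a: "a \<in> carrier (cocycles \<Gamma> X)"
  obtains f where "\<forall>n. f n \<in> carrier (borel_functions X)"
    "limitin (measure_topology d (discrete_times \<Gamma> X)) (\<lambda>n. coboundary \<Gamma> X (f n)) a sequentially"
proof -
  let ?Y = "discrete_times \<Gamma> X"
  obtain F :: "nat \<Rightarrow> ('a \<Rightarrow> 'a) set" where F: "\<forall>i. finite (F i) \<and> subgroup (F i) (full_group X \<Gamma>) \<and> F i \<subseteq> F (Suc i)"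
    "\<forall>x\<in>space X. orbit_of \<Gamma> x = (\<Union>i. orbit_of (F i) x)"
    using \<Gamma>(4) unfolding hyperfinite_def by (elim exE conjE)
  have "\<exists>f. f \<in> carrier (borel_functions X) \<and>
      (\<forall>\<gamma>\<in>\<Gamma>. \<forall>x\<in>space X. \<gamma> x \<in> orbit_of (F n) x \<longrightarrow> a (\<gamma>, x) = f (\<gamma> x) - f x)" for n
  proof -
    have Fn: "finite (F n)" "subgroup (F n) (full_group X \<Gamma>)" using F(1) by blast+
    show ?thesis
      by (rule cocycle_eq_coboundary_on_finite_orbits[OF X \<Gamma>(1-3) Fn a]) (intro exI conjI)
  qed
  then have "\<exists>f. \<forall>n. f n \<in> carrier (borel_functions X) \<and>
      (\<forall>\<gamma>\<in>\<Gamma>. \<forall>x\<in>space X. \<gamma> x \<in> orbit_of (F n) x \<longrightarrow> a (\<gamma>, x) = f n (\<gamma> x) - f n x)"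
    by (intro choice allI)
  then obtain f where f: "\<forall>n. f n \<in> carrier (borel_functions X) \<and>
      (\<forall>\<gamma>\<in>\<Gamma>. \<forall>x\<in>space X. \<gamma> x \<in> orbit_of (F n) x \<longrightarrow> a (\<gamma>, x) = f n (\<gamma> x) - f n x)"
    by (elim exE)
  show thesis
  proof (rule that)
    show "\<forall>n. f n \<in> carrier (borel_functions X)" using f by blast
    show "limitin (measure_topology d ?Y) (\<lambda>n. coboundary \<Gamma> X (f n)) a sequentially"
    proof (rule limitin_measure_topology_pointwise[OF d])
      show "coboundary \<Gamma> X (f n) \<in> carrier (borel_functions ?Y)" for n
        using coboundary_in_cocycles[OF \<Gamma>(1,2), of "f n"] f unfolding mem_cocycles by blast
      show "a \<in> carrier (borel_functions ?Y)" using a unfolding mem_cocycles by blast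
      fix p assume p: "p \<in> space ?Y"
      obtain \<gamma> x where px: "p = (\<gamma>, x)" by fastforce
      with p have \<gamma>: "\<gamma> \<in> \<Gamma>" and x: "x \<in> space X" by (auto simp: space_discrete_times)
      have "\<gamma> x \<in> orbit_of \<Gamma> x" using \<gamma> unfolding orbit_of_def by blast
      then obtain i where i: "\<gamma> x \<in> orbit_of (F i) x" using F(2) x by blast
      have "incseq F" using F(1) by (intro incseq_SucI) blast
      have "coboundary \<Gamma> X (f n) p = a p" if "i \<le> n" for n
      proof -
        have "F i \<subseteq> F n" using \<open>incseq F\<close> that by (rule incseqD)
        then have "\<gamma> x \<in> orbit_of (F n) x" using i unfolding orbit_of_def by blast
        then have "a (\<gamma>, x) = f n (\<gamma> x) - f n x" using f \<gamma> x by blast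
        then show ?thesis using p by (simp add: px coboundary_def)
      qed
      then show "(\<lambda>n. coboundary \<Gamma> X (f n) p) \<longlonglongrightarrow> a p"
        by (intro tendsto_eventually eventually_sequentiallyI)
    qed
  qed
qed

text \<open>The dense set is the coboundary image of a countable dense set of functions on
  \<open>X\<close>. It already lies among the cocycles, so density can be tested in the ambient
  space and nothing has to be inherited from its separability.\<close>

lemma separable_space_cocycles:
  fixes d :: "'g::{topological_ab_group_add, second_countable_topology} \<Rightarrow> 'g \<Rightarrow> real"
  assumes d: "invariant_compatible_metric d" and X: "standard_borel_space X"
    and \<Gamma>: "subgroup \<Gamma> (borel_Aut X)" "countable \<Gamma>" "acts_freely X \<Gamma>" "hyperfinite X \<Gamma>"
  shows "separable_space (subtopology (measure_topology d (discrete_times \<Gamma> X)) (carrier (cocycles \<Gamma> X)))"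
proof -
  let ?S = "measure_topology d X" and ?T = "measure_topology d (discrete_times \<Gamma> X)"
  let ?Z = "carrier (cocycles \<Gamma> X) :: (('a \<Rightarrow> 'a) \<times> 'a \<Rightarrow> 'g) set" and ?\<delta> = "coboundary \<Gamma> X :: ('a \<Rightarrow> 'g) \<Rightarrow> _"
  obtain c :: "nat \<Rightarrow> 'a set" where "sets X = sigma_sets (space X) (range c)"
    by (rule standard_borel_space_generator[OF X])
  then have "separable_space ?S" by (rule separable_space_measure_topology[OF d])
  then obtain D where D: "countable D" "D \<subseteq> topspace ?S" "?S closure_of D = topspace ?S"
    unfolding separable_space_def by (elim exE conjE)
  have \<delta>Z: "?\<delta> f \<in> ?Z" if "f \<in> topspace ?S" for f
    using that coboundary_in_cocycles[OF \<Gamma>(1,2)] by (simp add: topspace_measure_topology[OF d])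
  have "?\<delta> ` topspace ?S \<subseteq> ?T closure_of (?\<delta> ` D)"
    using continuous_map_image_closure_subset[OF continuous_map_coboundary[OF d \<Gamma>(2) subgroup.subset[OF \<Gamma>(1)]], of D]
    by (simp add: D(3))
  then have cob: "?\<delta> f \<in> ?T closure_of (?\<delta> ` D)" if "f \<in> carrier (borel_functions X)" for f
    using that by (auto simp: topspace_measure_topology[OF d])
  have "a \<in> ?T closure_of (?\<delta> ` D)" if a: "a \<in> ?Z" for a
  proof -
    obtain f where f: "\<forall>n. f n \<in> carrier (borel_functions X)" and lim: "limitin ?T (\<lambda>n. ?\<delta> (f n)) a sequentially"
      by (rule cocycle_limit_of_coboundaries[OF d X \<Gamma> a])
    show ?thesis
      \<comment> \<open>Two approximations are combined: the countable image is dense among the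
        coboundaries, and its closure, being closed, also contains limits of sequences of
        coboundaries.\<close>
      by (rule limitin_closedin[OF lim closedin_closure_of])
        (use cob f in simp_all)
  qed
  then have "?Z \<subseteq> ?T closure_of (?\<delta> ` D)" by blast
  moreover have DZ: "?\<delta> ` D \<subseteq> ?Z" using \<delta>Z D(2) by blast
  moreover have "topspace (subtopology ?T ?Z) = ?Z"
    using closedin_subset[OF closedin_cocycles[OF d \<Gamma>(1)]] by auto
  ultimately show ?thesis
    unfolding separable_space_def closure_of_subtopology using D(1)
    by (intro exI[of _ "?\<delta> ` D"]) (auto simp: Int_absorb1)
qed

theorem proposition3p6:
  fixes X :: "'a measure"
    and \<Gamma> :: "('a \<Rightarrow> 'a) set"
    and d :: "'g::{topological_ab_group_add, t2_space, second_countable_topology} \<Rightarrow> 'g \<Rightarrow> real"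
  assumes "standard_borel_space X"
    and "locally_compact_space (euclidean :: 'g topology)"
    and "invariant_compatible_metric d"
    and "subgroup \<Gamma> (borel_Aut X)" and "countable \<Gamma>"
    and "hyperfinite X \<Gamma>"
    and "acts_freely X \<Gamma>"
  shows "let Z = (cocycles \<Gamma> X :: (('a \<Rightarrow> 'a) \<times> 'a \<Rightarrow> 'g) monoid);
             \<T> = measure_topology d (discrete_times \<Gamma> X)
         in closedin \<T> (carrier Z) \<and>
            topological_group Z (subtopology \<T> (carrier Z)) \<and>
            separable_space (subtopology \<T> (carrier Z))"
proof -
  let ?Z = "cocycles \<Gamma> X :: (('a \<Rightarrow> 'a) \<times> 'a \<Rightarrow> 'g) monoid"
  let ?Y = "discrete_times \<Gamma> X"
  have "borel_functions ?Y\<lparr>carrier := carrier ?Z\<rparr> = ?Z" by (simp add: cocycles_def)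
  then have "topological_group ?Z (subtopology (measure_topology d ?Y) (carrier ?Z))"
    using topological_group_subgroup[OF topological_group_borel_functions[OF assms(3)] subgroup_cocycles[OF assms(4)]]
    by metis
  then show ?thesis
    using closedin_cocycles[OF assms(3,4)] separable_space_cocycles[OF assms(3,1,4,5,7,6)] by (simp add: Let_def)
qed

end
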